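(* Let the sensor set $\mathcal S^\star$ and the controllers $u_1^\star,u_2^\star,\ldots,u_T^\star$ be a solution to the sensing-constrained LQG problem $$\min_{\mathcal S\subseteq\mathcal V,\ |\mathcal S|\le k,\ u_{1:T}(\mathcal S)}\ \sum_{t=1}^T\mathbb E\left[\|x_{t+1}(\mathcal S)\|_{Q_t}^2+\|u_t(\mathcal S)\|_{R_t}^2\right].$$ Then $\mathcal S^\star$ and $u_1^\star,u_2^\star,\ldots,u_T^\star$ can be computed in cascade as follows: $$\mathcal S^\star\in\arg\min_{\mathcal S\subseteq\mathcal V,\ |\mathcal S|\le k}\ \sum_{t=1}^T\mathrm{tr}\left[\Theta_t\Sigma_{t|t}(\mathcal S)\right],$$ $$u_t^\star=K_t\,\hat x_t(\mathcal S^\star),\quad t=1,\ldots,T,$$ where $\hat x_t(\mathcal S)$ is the Kalman estimator of the state $x_t$ and $\Sigma_{t|t}(\mathcal S)$ is its error covariance. In addition, the matrices $\Theta_t$ and $K_t$ are independent of the selected sensor set $\mathcal S$, and they are computed as the solution of the backward Riccati recursion $$S_t=Q_t+N_{t+1},$$ $$N_t=A_t^{\mathsf T}(S_t^{-1}+B_tR_t^{-1}B_t^{\mathsf T})^{-1}A_t,$$ $$M_t=B_t^{\mathsf T}S_tB_t+R_t,$$ $$K_t=-M_t^{-1}B_t^{\mathsf T}S_tA_t,$$ $$\Theta_t=K_t^{\mathsf T}M_tK_t,$$ with boundary condition $N_{T+1}=0$.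
   Context: System: $x_{t+1}=A_tx_t+B_tu_t+w_t$ for $t=1,\ldots,T$ (finite horizon $T$), with state $x_t\in\mathbb R^{n_t}$ and control $u_t\in\mathbb R^{m_t}$; the initial condition $x_1$ is a Gaussian random variable with covariance $\Sigma_{1|0}$; the process noise $w_t$ is Gaussian with mean zero and covariance $W_t$. Sensors: $\mathcal V$ is a finite set of available sensors; sensor $i\in\mathcal V$ produces $y_{i,t}=C_{i,t}x_t+v_{i,t}\in\mathbb R^{p_{i,t}}$, where the measurement noise $v_{i,t}$ is Gaussian with mean zero and positive definite covariance $V_{i,t}$. The random variables $x_1$, $w_t$, $v_{i,t}$ ($i\in\mathcal V$, $t=1,\ldots,T$) are mutually independent. Active sensors: for an active sensor set $\mathcal S=\{i_1,\ldots,i_{|\mathcal S|}\}\subseteq\mathcal V$ (the same set is active at all times $t=1,\ldots,T$), $y_t(\mathcal S)$ is the stacked vector of $y_{i_1,t},\ldots,y_{i_{|\mathcal S|},t}$. Admissible control policies: $u_t=u_t(\mathcal S)$ is a function of $y_1(\mathcal S),\ldots,y_t(\mathcal S)$ only; $u_{1:T}(\mathcal S)=\{u_1(\mathcal S),\ldots,u_T(\mathcal S)\}$; $x_{t+1}(\mathcal S)$ denotes the resulting state. Cost: the $Q_t$ are positive semi-definite, the $R_t$ are positive definite, $\|v\|_M^2=v^{\mathsf T}Mv$, $k$ is a given cardinality bound, and the expectation is over $x_1$, the process noises and the measurement noises. Estimator: $\hat x_t(\mathcal S)=\mathbb E(x_t\mid y_1(\mathcal S),\ldots,y_t(\mathcal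 S))$ and $\Sigma_{t|t}(\mathcal S)=\mathbb E[(\hat x_t(\mathcal S)-x_t)(\hat x_t(\mathcal S)-x_t)^{\mathsf T}]$. The inverses written in the recursion are assumed to exist. *)

theory Defs
  imports
    "HOL-Probability.Probability"
    "Jordan_Normal_Form.Gauss_Jordan_Elimination"
begin

(* All dimensions vary with time (and sensor), so vectors and matrices are those of
   Jordan_Normal_Form, whose dimensions are terms.  The type names vec and mat below are
   qualified because HOL-Analysis has its own. *)

type_synonym rvec = "real Matrix.vec"
type_synonym rmat = "real Matrix.mat"

section \<open>Matrices\<close>

definition quad_form :: "rmat \<Rightarrow> rvec \<Rightarrow> real" where
  "quad_form P x = scalar_prod x (P *\<^sub>v x)"

definition pos_semidef :: "nat \<Rightarrow> rmat \<Rightarrow> bool" where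
  "pos_semidef n P \<longleftrightarrow> P \<in> carrier_mat n n \<and> transpose_mat P = P \<and>
     (\<forall>x\<in>carrier_vec n. 0 \<le> quad_form P x)"

definition pos_def :: "nat \<Rightarrow> rmat \<Rightarrow> bool" where
  "pos_def n P \<longleftrightarrow> P \<in> carrier_mat n n \<and> transpose_mat P = P \<and>
     (\<forall>x\<in>carrier_vec n. x \<noteq> 0\<^sub>v n \<longrightarrow> 0 < quad_form P x)"

(* Unspecified for singular matrices; the theorem assumes invertibility wherever it is used. *)
definition minv :: "rmat \<Rightarrow> rmat" where
  "minv P = the (mat_inverse P)"

definition mtrace :: "rmat \<Rightarrow> real" where
  "mtrace P = (\<Sum>i<dim_row P. P $$ (i, i))"

section \<open>Random vectors\<close>

(* The Borel sigma-algebra of real n-space, transported to carrier_vec n along coordinates. *)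
definition borel_vec :: "nat \<Rightarrow> rvec measure" where
  "borel_vec n = vimage_algebra (carrier_vec n) (\<lambda>x. \<lambda>i\<in>{..<n}. vec_index x i)
     (Pi\<^sub>M {..<n} (\<lambda>_. borel))"

definition normal_law :: "real \<Rightarrow> real \<Rightarrow> real measure" where
  "normal_law m s2 = (if s2 = 0 then return borel m
     else density lborel (\<lambda>x. ennreal (normal_density m (sqrt s2) x)))"

(* Possibly degenerate multivariate Gaussian: every linear functional is normally distributed. *)
definition gaussian :: "'w measure \<Rightarrow> nat \<Rightarrow> ('w \<Rightarrow> rvec) \<Rightarrow> rvec \<Rightarrow> rmat \<Rightarrow> bool" where
  "gaussian P n X m \<Sigma> \<longleftrightarrow>
     X \<in> measurable P (borel_vec n) \<and> m \<in> carrier_vec n \<and> pos_semidef n \<Sigma> \<and>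
     (\<forall>a\<in>carrier_vec n. distr P borel (\<lambda>\<omega>. scalar_prod a (X \<omega>)) =
        normal_law (scalar_prod a m) (quad_form \<Sigma> a))"

section \<open>The linear system, its sensors and its cost\<close>

record ('w, 'i) lqg =
  prob_measure :: "'w measure"
  horizon :: nat
  sensors :: "'i set"
  xdim :: "nat \<Rightarrow> nat"
  udim :: "nat \<Rightarrow> nat"
  ydim :: "'i \<Rightarrow> nat \<Rightarrow> nat"
  A_mat :: "nat \<Rightarrow> rmat"
  B_mat :: "nat \<Rightarrow> rmat"
  C_mat :: "'i \<Rightarrow> nat \<Rightarrow> rmat"
  Q_mat :: "nat \<Rightarrow> rmat"
  R_mat :: "nat \<Rightarrow> rmat"
  x_init :: "'w \<Rightarrow> rvec"
  w_noise :: "nat \<Rightarrow> 'w \<Rightarrow> rvec"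
  v_noise :: "'i \<Rightarrow> nat \<Rightarrow> 'w \<Rightarrow> rvec"
  Sigma_init :: rmat
  W_cov :: "nat \<Rightarrow> rmat"
  V_cov :: "'i \<Rightarrow> nat \<Rightarrow> rmat"

datatype 'i source = Initial | Process nat | Measurement 'i nat

fun source_dim :: "('w, 'i) lqg \<Rightarrow> 'i source \<Rightarrow> nat" where
  "source_dim L Initial = xdim L 1"
| "source_dim L (Process t) = xdim L (t + 1)"
| "source_dim L (Measurement i t) = ydim L i t"

fun source_rv :: "('w, 'i) lqg \<Rightarrow> 'i source \<Rightarrow> 'w \<Rightarrow> rvec" where
  "source_rv L Initial = x_init L"
| "source_rv L (Process t) = w_noise L t"
| "source_rv L (Measurement i t) = v_noise L i t"

(* Q_mat L t weighs the state at time t + 1, whose dimension may differ from that at time t. *)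
definition lqg_system :: "('w, 'i) lqg \<Rightarrow> bool" where
  "lqg_system L \<longleftrightarrow>
     prob_space (prob_measure L) \<and>
     finite (sensors L) \<and>
     (\<forall>t\<in>{1..horizon L}.
        A_mat L t \<in> carrier_mat (xdim L (t + 1)) (xdim L t) \<and>
        B_mat L t \<in> carrier_mat (xdim L (t + 1)) (udim L t) \<and>
        (\<forall>i\<in>sensors L. C_mat L i t \<in> carrier_mat (ydim L i t) (xdim L t)) \<and>
        pos_semidef (xdim L (t + 1)) (Q_mat L t) \<and>
        pos_def (udim L t) (R_mat L t)) \<and>
     (\<exists>m. gaussian (prob_measure L) (xdim L 1) (x_init L) m (Sigma_init L)) \<and>
     (\<forall>t\<in>{1..horizon L}.
        gaussian (prob_measure L) (xdim L (t + 1)) (w_noise L t)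
          (0\<^sub>v (xdim L (t + 1))) (W_cov L t)) \<and>
     (\<forall>t\<in>{1..horizon L}. \<forall>i\<in>sensors L.
        gaussian (prob_measure L) (ydim L i t) (v_noise L i t)
          (0\<^sub>v (ydim L i t)) (V_cov L i t) \<and>
        pos_def (ydim L i t) (V_cov L i t)) \<and>
     prob_space.indep_vars (prob_measure L) (\<lambda>s. borel_vec (source_dim L s)) (source_rv L)
       ({Initial} \<union> Process ` {1..horizon L} \<union>
        (\<lambda>(i, t). Measurement i t) ` (sensors L \<times> {1..horizon L}))"

section \<open>Control policies and closed-loop trajectories\<close>

(* An observation history up to time t is an extensional function on {1..t} assigning to each
   time the stacked measurement vector of the active sensors; a policy maps, at each time,
   such a history to a control. *)
type_synonym history = "nat \<Rightarrow> rvec"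
type_synonym policy = "nat \<Rightarrow> history \<Rightarrow> rvec"

(* The stacked measurement of the sensors in S at time t when the state is x. *)
definition stacked_output ::
  "('w, 'i::linorder) lqg \<Rightarrow> 'i set \<Rightarrow> nat \<Rightarrow> rvec \<Rightarrow> 'w \<Rightarrow> rvec" where
  "stacked_output L S t x \<omega> =
     foldr (@\<^sub>v) (map (\<lambda>i. C_mat L i t *\<^sub>v x + v_noise L i t \<omega>) (sorted_list_of_set S)) vNil"

lemma restrict_fundef_cong [fundef_cong]:
  "I = J \<Longrightarrow> (\<And>i. i \<in> J \<Longrightarrow> f i = g i) \<Longrightarrow> restrict f I = restrict g J"
  by (auto simp: restrict_def fun_eq_iff)

function state ::
  "('w, 'i::linorder) lqg \<Rightarrow> 'i set \<Rightarrow> policy \<Rightarrow> nat \<Rightarrow> 'w \<Rightarrow> rvec" where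
  "state L S \<pi> t \<omega> =
     (if t \<le> 1 then x_init L \<omega>
      else A_mat L (t - 1) *\<^sub>v state L S \<pi> (t - 1) \<omega>
         + B_mat L (t - 1) *\<^sub>v
             \<pi> (t - 1) (\<lambda>\<tau>\<in>{1..t - 1}. stacked_output L S \<tau> (state L S \<pi> \<tau> \<omega>) \<omega>)
         + w_noise L (t - 1) \<omega>)"
  by pat_completeness auto
termination
  by (relation "Wellfounded.measure (\<lambda>(L, S, \<pi>, t, \<omega>). t)") auto

declare state.simps [simp del]

definition observation ::
  "('w, 'i::linorder) lqg \<Rightarrow> 'i set \<Rightarrow> policy \<Rightarrow> nat \<Rightarrow> 'w \<Rightarrow> rvec" where
  "observation L S \<pi> t \<omega> = stacked_output L S t (state L S \<pi> t \<omega>) \<omega>"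

definition observations ::
  "('w, 'i::linorder) lqg \<Rightarrow> 'i set \<Rightarrow> policy \<Rightarrow> nat \<Rightarrow> 'w \<Rightarrow> history" where
  "observations L S \<pi> t \<omega> = (\<lambda>\<tau>\<in>{1..t}. observation L S \<pi> \<tau> \<omega>)"

definition control ::
  "('w, 'i::linorder) lqg \<Rightarrow> 'i set \<Rightarrow> policy \<Rightarrow> nat \<Rightarrow> 'w \<Rightarrow> rvec" where
  "control L S \<pi> t \<omega> = \<pi> t (observations L S \<pi> t \<omega>)"

definition history_algebra :: "('w, 'i) lqg \<Rightarrow> 'i set \<Rightarrow> nat \<Rightarrow> history measure" where
  "history_algebra L S t = Pi\<^sub>M {1..t} (\<lambda>\<tau>. borel_vec (\<Sum>i\<in>S. ydim L i \<tau>))"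

definition admissible :: "('w, 'i) lqg \<Rightarrow> 'i set \<Rightarrow> policy \<Rightarrow> bool" where
  "admissible L S \<pi> \<longleftrightarrow>
     (\<forall>t\<in>{1..horizon L}. \<pi> t \<in> measurable (history_algebra L S t) (borel_vec (udim L t)))"

definition square_integrable_control ::
  "('w, 'i::linorder) lqg \<Rightarrow> 'i set \<Rightarrow> policy \<Rightarrow> bool" where
  "square_integrable_control L S \<pi> \<longleftrightarrow>
     (\<forall>t\<in>{1..horizon L}. integrable (prob_measure L)
        (\<lambda>\<omega>. scalar_prod (control L S \<pi> t \<omega>) (control L S \<pi> t \<omega>)))"

(* The integrand is nonnegative, so the expectation is taken in [0, infinity] and no
   integrability is required of a policy. *)
definition lqg_cost :: "('w, 'i::linorder) lqg \<Rightarrow> 'i set \<Rightarrow> policy \<Rightarrow> ennreal" where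
  "lqg_cost L S \<pi> = (\<Sum>t = 1..horizon L. \<integral>\<^sup>+ \<omega>.
     ennreal (quad_form (Q_mat L t) (state L S \<pi> (t + 1) \<omega>)
            + quad_form (R_mat L t) (control L S \<pi> t \<omega>)) \<partial>prob_measure L)"

definition lqg_solution :: "('w, 'i::linorder) lqg \<Rightarrow> nat \<Rightarrow> 'i set \<Rightarrow> policy \<Rightarrow> bool" where
  "lqg_solution L k S \<pi> \<longleftrightarrow>
     is_arg_min (\<lambda>(S', u). lqg_cost L S' u)
       (\<lambda>(S', u). S' \<subseteq> sensors L \<and> card S' \<le> k \<and> admissible L S' u) (S, \<pi>)"

section \<open>Estimator\<close>

definition estimate ::
  "('w, 'i::linorder) lqg \<Rightarrow> 'i set \<Rightarrow> policy \<Rightarrow> nat \<Rightarrow> 'w \<Rightarrow> rvec" where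
  "estimate L S \<pi> t \<omega> = Matrix.vec (xdim L t) (\<lambda>i.
     real_cond_exp (prob_measure L)
       (vimage_algebra (space (prob_measure L)) (observations L S \<pi> t) (history_algebra L S t))
       (\<lambda>\<omega>'. vec_index (state L S \<pi> t \<omega>') i) \<omega>)"

definition error_cov ::
  "('w, 'i::linorder) lqg \<Rightarrow> 'i set \<Rightarrow> policy \<Rightarrow> nat \<Rightarrow> rmat" where
  "error_cov L S \<pi> t = Matrix.mat (xdim L t) (xdim L t) (\<lambda>(i, j).
     \<integral>\<omega>. (vec_index (estimate L S \<pi> t \<omega>) i - vec_index (state L S \<pi> t \<omega>) i)
        * (vec_index (estimate L S \<pi> t \<omega>) j - vec_index (state L S \<pi> t \<omega>) j) \<partial>prob_measure L)"

section \<open>Backward Riccati recursion\<close>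

function riccati_S :: "('w, 'i) lqg \<Rightarrow> nat \<Rightarrow> rmat"
  and riccati_N :: "('w, 'i) lqg \<Rightarrow> nat \<Rightarrow> rmat" where
  "riccati_S L t = Q_mat L t + riccati_N L (t + 1)"
| "riccati_N L t =
     (if horizon L < t then 0\<^sub>m (xdim L (horizon L + 1)) (xdim L (horizon L + 1))
      else transpose_mat (A_mat L t)
         * minv (minv (riccati_S L t)
                 + B_mat L t * minv (R_mat L t) * transpose_mat (B_mat L t))
         * A_mat L t)"
  by pat_completeness auto
termination
  by (relation "Wellfounded.measure (case_sum
        (\<lambda>(L, t). 2 * (horizon L + 1 - t) + 1)
        (\<lambda>(L, t). 2 * (horizon L + 2 - t)))") auto

declare riccati_S.simps [simp del] riccati_N.simps [simp del]

definition riccati_M :: "('w, 'i) lqg \<Rightarrow> nat \<Rightarrow> rmat" where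
  "riccati_M L t = transpose_mat (B_mat L t) * riccati_S L t * B_mat L t + R_mat L t"

definition riccati_K :: "('w, 'i) lqg \<Rightarrow> nat \<Rightarrow> rmat" where
  "riccati_K L t =
     - (minv (riccati_M L t) * transpose_mat (B_mat L t) * riccati_S L t * A_mat L t)"

definition riccati_Theta :: "('w, 'i) lqg \<Rightarrow> nat \<Rightarrow> rmat" where
  "riccati_Theta L t = transpose_mat (riccati_K L t) * riccati_M L t * riccati_K L t"

definition riccati_invertible :: "('w, 'i) lqg \<Rightarrow> bool" where
  "riccati_invertible L \<longleftrightarrow> (\<forall>t\<in>{1..horizon L}.
     invertible_mat (riccati_S L t) \<and>
     invertible_mat (R_mat L t) \<and>
     invertible_mat (minv (riccati_S L t)
       + B_mat L t * minv (R_mat L t) * transpose_mat (B_mat L t)) \<and>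
     invertible_mat (riccati_M L t))"

section \<open>The sensor selection criterion\<close>

definition sensing_cost :: "('w, 'i::linorder) lqg \<Rightarrow> 'i set \<Rightarrow> policy \<Rightarrow> real" where
  "sensing_cost L S \<pi> = (\<Sum>t = 1..horizon L. mtrace (riccati_Theta L t * error_cov L S \<pi> t))"

(* The error covariance of a sensor set is that of the trajectory steered by some control law
   u(S).  It does not in fact depend on which one, and the definition asserts minimality for
   every choice of control laws S \<mapsto> u(S); they must be square integrable because
   otherwise the conditional expectation of the state need not exist. *)
definition sensing_optimal :: "('w, 'i::linorder) lqg \<Rightarrow> nat \<Rightarrow> 'i set \<Rightarrow> bool" where
  "sensing_optimal L k S \<longleftrightarrow>
     (\<forall>u. (\<forall>S'. S' \<subseteq> sensors L \<and> card S' \<le> k \<longrightarrow>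
             admissible L S' (u S') \<and> square_integrable_control L S' (u S')) \<longrightarrow>
        is_arg_min (\<lambda>S'. sensing_cost L S' (u S'))
          (\<lambda>S'. S' \<subseteq> sensors L \<and> card S' \<le> k) S)"

end

theory Submission
  imports Defs
begin

text \<open>
  Completing the square along the Riccati recursion turns the cost of a square integrable policy into
  a constant, plus \<open>\<Sum>\<^sub>t E|u\<^sub>t - K\<^sub>t x\<^sub>t|\<^sup>2\<close> in the norm of \<open>M\<^sub>t\<close>; the cross terms vanish because
  \<open>w\<^sub>t\<close> has mean zero and is independent of the past. Since \<open>u\<^sub>t\<close> is a function of the measurements, the
  conditional expectation splits each summand orthogonally into the regret
  \<open>E|u\<^sub>t - K\<^sub>t E(x\<^sub>t | y\<^sub>1, \<dots>, y\<^sub>t)|\<^sup>2\<close> and \<open>tr (\<Theta>\<^sub>t \<Sigma>\<^sub>t)\<close>. The error covariance does not depend on the policy: controls shift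
  state and measurements by known amounts, so all policies generate the same information. As
  zero regret is attained for every sensor set and policies of infinite second moment have infinite
  cost, optimality means minimal \<open>\<Sum>\<^sub>t tr (\<Theta>\<^sub>t \<Sigma>\<^sub>t)\<close> together with zero regret.
\<close>

text \<open>Integrability and causality, rather than algebra, shape the proof. The cost lives in
  [0, infinity] and a policy is any measurable map of histories, whereas the orthogonality relations
  need second moments. So square integrability has to be earned: for an optimal policy it comes from
  finite cost and definiteness of \<open>R_t\<close>; for a policy that obeys
  \<open>u_t = K_t E(x_t | y_1, ..., y_t)\<close> it is propagated forward in time. The certainty
  equivalent law also looks circular, since the estimate it uses depends on the policy being defined
  and is a function of the sample point rather than of a history; causality and Doob-Dynkin
  factorization resolve this. The estimator is treated as an orthogonal projection in L^2, with no
  gain formula; Gaussian laws enter through means and second moments. The inverse in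
  \<open>N_t\<close> is not rewritten by a matrix inversion identity:
  \<open>p = (S^-1 + B R^-1 B^T)^-1 A x\<close> is the costate of the one-step minimization, and the
  minimum is read off from it as the inner product of \<open>A x\<close> and
  \<open>p\<close>.\<close>

unbundle no vec_syntax and no inner_syntax

section \<open>Linear algebra\<close>

text \<open>\<open>invertible_mat\<close> supplies an inverse whose dimensions are not stated; they
  are read off from the two product identities. Only then is \<open>P\<close> a unit of the matrix
  ring, which is what excludes the \<open>None\<close> case of \<open>mat_inverse\<close>.\<close>

lemma minv_props:
  assumes "P \<in> carrier_mat n n" "invertible_mat P"
  shows minv_carrier: "minv P \<in> carrier_mat n n"
    and minv_right: "P * minv P = 1\<^sub>m n"
    and minv_left: "minv P * P = 1\<^sub>m n"
proof -
  from assms obtain B where B: "P * B = 1\<^sub>m n" "B * P = 1\<^sub>m (dim_row B)"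
    unfolding invertible_mat_def inverts_mat_def by auto
  have "dim_row B = n"
    using arg_cong[OF B(2), of dim_col] assms(1) by simp
  moreover have "dim_col B = n"
    using arg_cong[OF B(1), of dim_col] by simp
  ultimately have "P \<in> Units (ring_mat TYPE(real) n ())"
    using B assms(1) unfolding Units_def ring_mat_def by (auto intro!: bexI[of _ B])
  then obtain C where "mat_inverse P = Some C"
    using mat_inverse(1)[OF assms(1), where b = "()"] by (cases "mat_inverse P") auto
  then show "minv P \<in> carrier_mat n n" "P * minv P = 1\<^sub>m n" "minv P * P = 1\<^sub>m n"
    using mat_inverse(2)[OF assms(1)] unfolding minv_def by auto
qed

lemma minv_mult_vec:
  assumes "P \<in> carrier_mat n n" "invertible_mat P" "x \<in> carrier_vec n"
  shows "P *\<^sub>v (minv P *\<^sub>v x) = x" "minv P *\<^sub>v (P *\<^sub>v x) = x"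
  using assoc_mult_mat_vec[OF assms(1) minv_carrier[OF assms(1,2)] assms(3)]
    assoc_mult_mat_vec[OF minv_carrier[OF assms(1,2)] assms(1) assms(3)]
    minv_right[OF assms(1,2)] minv_left[OF assms(1,2)] assms(3)
  by auto

text \<open>The transposed inverse is a left inverse of \<open>P\<close>, and a left inverse
  coincides with a right inverse.\<close>

lemma minv_symmetric:
  assumes P: "P \<in> carrier_mat n n" and inv: "invertible_mat P" and sym: "transpose_mat P = P"
  shows "transpose_mat (minv P) = minv P"
proof -
  note C = minv_carrier[OF P inv]
  have "transpose_mat (minv P) * P = 1\<^sub>m n"
    using arg_cong[OF minv_right[OF P inv], of transpose_mat] transpose_mult[OF P C] sym by simp
  then have "transpose_mat (minv P) * P * minv P = minv P"
    using C by simp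
  moreover have "transpose_mat (minv P) * P * minv P = transpose_mat (minv P)"
    using assoc_mult_mat[OF transpose_carrier_mat[THEN iffD2, OF C] P C] minv_right[OF P inv] C by simp
  ultimately show ?thesis by simp
qed

lemma scalar_prod_transpose_mult:
  fixes P :: rmat
  assumes "P \<in> carrier_mat n m" "x \<in> carrier_vec n" "y \<in> carrier_vec m"
  shows "y \<bullet> (transpose_mat P *\<^sub>v x) = (P *\<^sub>v y) \<bullet> x"
  using assms transpose_vec_mult_scalar[OF assms(1,3,2)]
  by (metis carrier_matI comm_scalar_prod mult_mat_vec_carrier transpose_carrier_mat)

lemma scalar_prod_symmetric_mult:
  fixes P :: rmat
  assumes "P \<in> carrier_mat n n" "transpose_mat P = P" "x \<in> carrier_vec n" "y \<in> carrier_vec n"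
  shows "x \<bullet> (P *\<^sub>v y) = y \<bullet> (P *\<^sub>v x)"
  using scalar_prod_transpose_mult[OF assms(1,3,4)] assms
  by (metis comm_scalar_prod mult_mat_vec_carrier)

lemma quad_form_add_vec:
  assumes P: "P \<in> carrier_mat n n" "transpose_mat P = P" and x: "x \<in> carrier_vec n" and y: "y \<in> carrier_vec n"
  shows "quad_form P (x + y) = quad_form P x + 2 * (y \<bullet> (P *\<^sub>v x)) + quad_form P y"
proof -
  have c: "P *\<^sub>v x \<in> carrier_vec n" "P *\<^sub>v y \<in> carrier_vec n" using P x y by auto
  show ?thesis
    unfolding quad_form_def mult_add_distrib_mat_vec[OF P(1) x y]
    using scalar_prod_symmetric_mult[OF P x y]
    by (simp add: add_scalar_prod_distrib[OF x y add_carrier_vec[OF c]] scalar_prod_add_distrib[OF x c]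
        scalar_prod_add_distrib[OF y c])
qed

lemma quad_form_add_mat:
  assumes "P \<in> carrier_mat n n" "P' \<in> carrier_mat n n" "x \<in> carrier_vec n"
  shows "quad_form (P + P') x = quad_form P x + quad_form P' x"
  unfolding quad_form_def add_mult_distrib_mat_vec[OF assms]
  using assms by (simp add: scalar_prod_add_distrib[of _ n])

lemma quad_form_congruence:
  assumes P: "P \<in> carrier_mat n n" and A: "A \<in> carrier_mat n m" and x: "x \<in> carrier_vec m"
  shows "quad_form (transpose_mat A * P * A) x = quad_form P (A *\<^sub>v x)"
proof -
  have "(transpose_mat A * P * A) *\<^sub>v x = transpose_mat A *\<^sub>v (P *\<^sub>v (A *\<^sub>v x))"
    using P A x by (simp add: assoc_mult_mat_vec[of _ m n _ m] assoc_mult_mat_vec[of _ m n _ n])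
  then show ?thesis
    unfolding quad_form_def using scalar_prod_transpose_mult[OF A _ x] P A x by simp
qed

lemma symmetric_congruence:
  fixes P :: rmat
  assumes P: "P \<in> carrier_mat n n" "transpose_mat P = P" and A: "A \<in> carrier_mat n m"
  shows "transpose_mat (transpose_mat A * P * A) = transpose_mat A * P * A"
proof -
  have At: "transpose_mat A \<in> carrier_mat m n" using A by simp
  have "transpose_mat (transpose_mat A * P * A) = transpose_mat A * transpose_mat (transpose_mat A * P)"
    using transpose_mult[OF mult_carrier_mat[OF At P(1)] A] .
  also have "transpose_mat (transpose_mat A * P) = P * A"
    using transpose_mult[OF At P(1)] P(2) by simp
  finally show ?thesis using assoc_mult_mat[OF At P(1) A] by simp
qed

lemma pos_def_imp_semidef: "pos_def n P \<Longrightarrow> pos_semidef n P"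
  unfolding pos_def_def pos_semidef_def
  by (metis (no_types, lifting) less_eq_real_def mult_mat_vec_carrier quad_form_def scalar_prod_left_zero)

lemma pos_semidef_add: "pos_semidef n P \<Longrightarrow> pos_semidef n P' \<Longrightarrow> pos_semidef n (P + P')"
  unfolding pos_semidef_def by (auto simp: quad_form_add_mat transpose_add[of _ n n])

lemma pos_semidef_congruence:
  assumes "pos_semidef n P" "A \<in> carrier_mat n m"
  shows "pos_semidef m (transpose_mat A * P * A)"
  using assms unfolding pos_semidef_def
  by (auto simp: quad_form_congruence[of _ n] symmetric_congruence[of _ n] simp del: transpose_mult)

lemma pos_def_add_semidef: "pos_semidef n P \<Longrightarrow> pos_def n P' \<Longrightarrow> pos_def n (P + P')"
  unfolding pos_semidef_def pos_def_def
  by (auto simp: quad_form_add_mat transpose_add[of _ n n] intro!: add_nonneg_pos)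

text \<open>Cauchy--Schwarz in the inner product of \<open>P\<close>, applied to \<open>x\<close> and \<open>P\<^sup>-\<^sup>1 e\<^sub>i\<close>.\<close>

lemma pos_def_coordinate_bound:
  assumes P: "pos_def n P" and inv: "invertible_mat P" and i: "i < n"
  obtains c where "\<And>x. x \<in> carrier_vec n \<Longrightarrow> (vec_index x i)\<^sup>2 \<le> c * quad_form P x"
proof
  define z where "z = minv P *\<^sub>v unit_vec n i"
  have Pc: "P \<in> carrier_mat n n" "transpose_mat P = P" using P unfolding pos_def_def by auto
  have z: "z \<in> carrier_vec n" unfolding z_def using minv_carrier[OF Pc(1) inv] by simp
  have Pz: "P *\<^sub>v z = unit_vec n i" unfolding z_def using minv_mult_vec[OF Pc(1) inv] by simp
  fix x :: rvec assume x: "x \<in> carrier_vec n"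
  have xz: "x \<bullet> (P *\<^sub>v z) = vec_index x i" unfolding Pz using i x by simp
  \<comment> \<open>This fixes the constant \<open>c\<close> as \<open>quad_form P z\<close>, which
    is the \<open>i\<close>-th diagonal entry of the inverse of \<open>P\<close>.\<close>
  show "(vec_index x i)\<^sup>2 \<le> quad_form P z * quad_form P x"
  proof (cases "quad_form P z = 0")
    case True
    then have "z = 0\<^sub>v n" using P z unfolding pos_def_def by force
    moreover have "P *\<^sub>v 0\<^sub>v n = 0\<^sub>v n" using Pc by (intro eq_vecI) auto
    ultimately have "vec_index x i = 0" using xz x by simp
    then show ?thesis using True by simp
  next
    case False
    \<comment> \<open>The minimizer over \<open>l\<close> of the quadratic polynomial
      \<open>quad_form P (x + l z)\<close>; its nonnegativity at this point is the claim.\<close>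
    define l where "l = - (vec_index x i / quad_form P z)"
    have "z \<noteq> 0\<^sub>v n" using False Pc unfolding quad_form_def by auto
    then have pos: "quad_form P z > 0" using P z unfolding pos_def_def by auto
    have "0 \<le> quad_form P (x + l \<cdot>\<^sub>v z)"
      using pos_def_imp_semidef[OF P] x z unfolding pos_semidef_def by simp
    also have "\<dots> = quad_form P x + 2 * (l * (z \<bullet> (P *\<^sub>v x))) + l * (l * quad_form P z)"
      using quad_form_add_vec[OF Pc x, of "l \<cdot>\<^sub>v z"] z x Pc
      by (simp add: quad_form_def mult_mat_vec[OF Pc(1)])
    also have "z \<bullet> (P *\<^sub>v x) = vec_index x i" using scalar_prod_symmetric_mult[OF Pc x z] xz by simp
    finally show ?thesis using pos unfolding l_def by (simp add: field_simps power2_eq_square)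
  qed
qed

text \<open>The premise on \<open>R *\<^sub>v v\<close> says that \<open>v\<close> is a stationary
  point of the left-hand side as a function of \<open>u\<close>, with \<open>p\<close> half the
  gradient of the \<open>S\<close> term. Stating this through \<open>p\<close> keeps inverses out,
  and the minimum becomes the bilinear expression \<open>z \<bullet> p\<close>.\<close>

lemma complete_square:
  assumes S: "S \<in> carrier_mat n n" "transpose_mat S = S"
    and R: "R \<in> carrier_mat m m" "transpose_mat R = R"
    and B: "B \<in> carrier_mat n m"
    and z: "z \<in> carrier_vec n" and u: "u \<in> carrier_vec m" and v: "v \<in> carrier_vec m"
    and p: "p = S *\<^sub>v (z + B *\<^sub>v v)"
    and Rv: "R *\<^sub>v v = - (transpose_mat B *\<^sub>v p)"
  shows "quad_form S (z + B *\<^sub>v u) + quad_form R u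
     = z \<bullet> p + quad_form (transpose_mat B * S * B + R) (u - v)"
proof -
  define e where "e = u - v"
  have e: "e \<in> carrier_vec m" and ue: "u = v + e" unfolding e_def using u v by auto
  have Bv: "B *\<^sub>v v \<in> carrier_vec n" "B *\<^sub>v e \<in> carrier_vec n" "z + B *\<^sub>v v \<in> carrier_vec n"
    using B z v e by auto
  have pc: "p \<in> carrier_vec n" unfolding p using S Bv by auto
  have "z + B *\<^sub>v u = (z + B *\<^sub>v v) + B *\<^sub>v e"
    unfolding ue mult_add_distrib_mat_vec[OF B v e] using assoc_add_vec[OF z Bv(1,2)] by simp
  then have 1: "quad_form S (z + B *\<^sub>v u)
      = quad_form S (z + B *\<^sub>v v) + 2 * ((B *\<^sub>v e) \<bullet> p) + quad_form S (B *\<^sub>v e)"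
    using quad_form_add_vec[OF S Bv(3,2)] p by simp
  have 2: "quad_form R u = quad_form R v + 2 * (e \<bullet> (R *\<^sub>v v)) + quad_form R e"
    unfolding ue using quad_form_add_vec[OF R v e] by simp
  have 3: "quad_form (transpose_mat B * S * B + R) e = quad_form S (B *\<^sub>v e) + quad_form R e"
    using quad_form_add_mat[OF _ R(1) e, of "transpose_mat B * S * B"] quad_form_congruence[OF S(1) B e] B S
    by simp
  \<comment> \<open>Stationarity tested in a direction \<open>y\<close>: with \<open>y = e\<close>
    it cancels the cross terms, with \<open>y = v\<close> it evaluates the minimum.\<close>
  have t: "y \<bullet> (R *\<^sub>v v) = - ((B *\<^sub>v y) \<bullet> p)" if "y \<in> carrier_vec m" for y
    unfolding Rv using scalar_prod_transpose_mult[OF B pc that] that B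
    by (simp add: scalar_prod_uminus_right)
  have 4: "quad_form S (z + B *\<^sub>v v) = z \<bullet> p + (B *\<^sub>v v) \<bullet> p"
    unfolding quad_form_def p[symmetric] using add_scalar_prod_distrib[OF z Bv(1) pc] .
  show ?thesis
    unfolding e_def[symmetric] 1 2 3 4 using t[OF e] t[OF v] by (simp add: quad_form_def)
qed

lemma mtrace_mult:
  assumes "P \<in> carrier_mat n n" "P' \<in> carrier_mat n n"
  shows "mtrace (P * P') = (\<Sum>i<n. \<Sum>j<n. P $$ (i, j) * P' $$ (j, i))"
  unfolding mtrace_def using assms
  by (auto simp: scalar_prod_def atLeast0LessThan intro!: sum.cong)

lemma quad_form_eq_sum:
  assumes "P \<in> carrier_mat n n" "x \<in> carrier_vec n"
  shows "quad_form P x = (\<Sum>i<n. \<Sum>j<n. P $$ (i, j) * (vec_index x i * vec_index x j))"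
  unfolding quad_form_def using assms
  by (auto simp: scalar_prod_def atLeast0LessThan sum_distrib_left ac_simps intro!: sum.cong)

section \<open>The Riccati recursion\<close>

lemma riccati_N_terminal:
  "riccati_N L (Suc (horizon L)) = 0\<^sub>m (xdim L (Suc (horizon L))) (xdim L (Suc (horizon L)))"
  by (simp add: riccati_N.simps)

text \<open>One step of dynamic programming: \<open>N_t\<close> is the minimum over \<open>u\<close>
  of the cost of a stage plus the cost-to-go, and \<open>K_t x\<close> is the minimizer.
  Semidefiniteness of \<open>N_t\<close> is a consequence, as a minimum of nonnegative
  values.\<close>

lemma riccati_step:
  assumes t: "t \<in> {1..horizon L}" and inv: "riccati_invertible L"
    and A: "A_mat L t \<in> carrier_mat (xdim L (Suc t)) (xdim L t)"
    and B: "B_mat L t \<in> carrier_mat (xdim L (Suc t)) (udim L t)"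
    and R: "pos_def (udim L t) (R_mat L t)"
    and S: "pos_semidef (xdim L (Suc t)) (riccati_S L t)"
  shows riccati_M_pos_def: "pos_def (udim L t) (riccati_M L t)"
    and riccati_K_carrier: "riccati_K L t \<in> carrier_mat (udim L t) (xdim L t)"
    and riccati_N_semidef: "pos_semidef (xdim L t) (riccati_N L t)"
    and riccati_complete_square: "\<And>x u. x \<in> carrier_vec (xdim L t) \<Longrightarrow> u \<in> carrier_vec (udim L t) \<Longrightarrow>
      quad_form (riccati_S L t) (A_mat L t *\<^sub>v x + B_mat L t *\<^sub>v u) + quad_form (R_mat L t) u
      = quad_form (riccati_N L t) x + quad_form (riccati_M L t) (u - riccati_K L t *\<^sub>v x)"
proof -
  let ?n = "xdim L (Suc t)" and ?m = "udim L t" and ?k = "xdim L t"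
  let ?S = "riccati_S L t" and ?R = "R_mat L t" and ?A = "A_mat L t" and ?B = "B_mat L t"
  let ?Y = "minv ?S + ?B * minv ?R * transpose_mat ?B"
  have Sc: "?S \<in> carrier_mat ?n ?n" "transpose_mat ?S = ?S" using S unfolding pos_semidef_def by auto
  have Rc: "?R \<in> carrier_mat ?m ?m" "transpose_mat ?R = ?R" using R unfolding pos_def_def by auto
  have iS: "invertible_mat ?S" and iR: "invertible_mat ?R" and iY: "invertible_mat ?Y"
    and iM: "invertible_mat (riccati_M L t)"
    using inv t unfolding riccati_invertible_def by auto
  have Bt: "transpose_mat ?B \<in> carrier_mat ?m ?n" and At: "transpose_mat ?A \<in> carrier_mat ?k ?n"
    using B A by auto
  note mS = minv_carrier[OF Sc(1) iS] and mR = minv_carrier[OF Rc(1) iR]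
  have Bm: "?B * minv ?R \<in> carrier_mat ?n ?m" using B mR by simp
  have BRB: "?B * minv ?R * transpose_mat ?B \<in> carrier_mat ?n ?n" using Bm Bt by simp
  have Y: "?Y \<in> carrier_mat ?n ?n" using mS BRB by simp
  have Ysym: "transpose_mat ?Y = ?Y"
    using minv_symmetric[OF Sc(1) iS Sc(2)] symmetric_congruence[OF mR minv_symmetric[OF Rc(1) iR Rc(2)], of "transpose_mat ?B" ?n]
      Bt transpose_add[OF mS BRB] by simp
  note mY = minv_carrier[OF Y iY]
  show M: "pos_def ?m (riccati_M L t)"
    unfolding riccati_M_def by (intro pos_def_add_semidef pos_semidef_congruence[OF S B] R)
  then have Mc: "riccati_M L t \<in> carrier_mat ?m ?m" unfolding pos_def_def by auto
  note mM = minv_carrier[OF Mc iM]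
  have MB: "minv (riccati_M L t) * transpose_mat ?B \<in> carrier_mat ?m ?n" using mM Bt by simp
  have MBS: "minv (riccati_M L t) * transpose_mat ?B * ?S \<in> carrier_mat ?m ?n" using MB Sc by simp
  then show Kc: "riccati_K L t \<in> carrier_mat ?m ?k" unfolding riccati_K_def using A by simp
  have N: "riccati_N L t = transpose_mat ?A * minv ?Y * ?A"
    using t by (simp add: riccati_N.simps)
  have Nsym: "riccati_N L t \<in> carrier_mat ?k ?k" "transpose_mat (riccati_N L t) = riccati_N L t"
    unfolding N using symmetric_congruence[OF mY minv_symmetric[OF Y iY Ysym] A] A mY by auto
  show sq: "quad_form ?S (?A *\<^sub>v x + ?B *\<^sub>v u) + quad_form ?R u
      = quad_form (riccati_N L t) x + quad_form (riccati_M L t) (u - riccati_K L t *\<^sub>v x)"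
    if x: "x \<in> carrier_vec ?k" and u: "u \<in> carrier_vec ?m" for x u
  proof -
    define z where "z = ?A *\<^sub>v x"
    \<comment> \<open>With \<open>v\<close> as in the next line, \<open>?Y *\<^sub>v p = z\<close>
      rearranges to \<open>minv S p = z + B v\<close>, that is, \<open>p = S (z + B v)\<close>. This
      is the premise of \<open>complete_square\<close>, and \<open>z \<bullet> p\<close> is then
      \<open>quad_form (riccati_N L t) x\<close> by the very shape of \<open>N_t\<close>.\<close>
    define p where "p = minv ?Y *\<^sub>v z"
    define v where "v = - (minv ?R *\<^sub>v (transpose_mat ?B *\<^sub>v p))"
    have z: "z \<in> carrier_vec ?n" unfolding z_def using A x by simp
    have p: "p \<in> carrier_vec ?n" unfolding p_def using mY z by simp
    have Bp: "transpose_mat ?B *\<^sub>v p \<in> carrier_vec ?m" using Bt p by simp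
    have RBp: "minv ?R *\<^sub>v (transpose_mat ?B *\<^sub>v p) \<in> carrier_vec ?m" using mR Bp by simp
    have v: "v \<in> carrier_vec ?m" unfolding v_def using mR Bp by simp
    have Bv: "?B *\<^sub>v v \<in> carrier_vec ?n" using B v by simp
    have Sp: "minv ?S *\<^sub>v p \<in> carrier_vec ?n" using mS p by simp
    have mult_uminus: "D *\<^sub>v (- w) = - (D *\<^sub>v w)" if "D \<in> carrier_mat r c" "w \<in> carrier_vec c" for D :: rmat and w r c
      using that by (intro eq_vecI) auto
    have "?Y *\<^sub>v p = z" unfolding p_def using minv_mult_vec[OF Y iY z] by simp
    moreover have "?Y *\<^sub>v p = minv ?S *\<^sub>v p + ?B *\<^sub>v (minv ?R *\<^sub>v (transpose_mat ?B *\<^sub>v p))"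
      using add_mult_distrib_mat_vec[OF mS BRB p] assoc_mult_mat_vec[OF Bm Bt p] assoc_mult_mat_vec[OF B mR Bp]
      by simp
    moreover have "?B *\<^sub>v (minv ?R *\<^sub>v (transpose_mat ?B *\<^sub>v p)) = - (?B *\<^sub>v v)"
      unfolding v_def mult_uminus[OF B RBp] by simp
    ultimately have "z = minv ?S *\<^sub>v p + - (?B *\<^sub>v v)" by simp
    then have "minv ?S *\<^sub>v p = z + ?B *\<^sub>v v" using Sp Bv z by (intro eq_vecI) auto
    then have pS: "p = ?S *\<^sub>v (z + ?B *\<^sub>v v)" using minv_mult_vec(1)[OF Sc(1) iS p] by simp
    have Rv: "?R *\<^sub>v v = - (transpose_mat ?B *\<^sub>v p)"
      unfolding v_def mult_uminus[OF Rc(1) RBp] using minv_mult_vec(1)[OF Rc(1) iR Bp] by simp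
    have SBv: "?S *\<^sub>v (?B *\<^sub>v v) \<in> carrier_vec ?n" "?S *\<^sub>v z \<in> carrier_vec ?n" using Sc Bv z by auto
    have BSB: "transpose_mat ?B * ?S * ?B \<in> carrier_mat ?m ?m"
      "transpose_mat ?B * ?S \<in> carrier_mat ?m ?n" using Bt Sc B by auto
    \<comment> \<open>Eliminating \<open>p\<close> from \<open>R v = - B^T p\<close> by
      \<open>p = S z + S B v\<close> gives \<open>M v = - B^T S z\<close>, which identifies
      \<open>v\<close>, so far expressed through \<open>R\<close> and \<open>p\<close>, with
      \<open>K_t x\<close>.\<close>
    have "riccati_M L t *\<^sub>v v = transpose_mat ?B *\<^sub>v (?S *\<^sub>v (?B *\<^sub>v v)) + ?R *\<^sub>v v"
      unfolding riccati_M_def add_mult_distrib_mat_vec[OF BSB(1) Rc(1) v] assoc_mult_mat_vec[OF BSB(2) B v]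
        assoc_mult_mat_vec[OF Bt Sc(1) Bv] by simp
    also have "\<dots> = - (transpose_mat ?B *\<^sub>v (?S *\<^sub>v z))"
      unfolding Rv pS mult_add_distrib_mat_vec[OF Sc(1) z Bv] mult_add_distrib_mat_vec[OF Bt SBv(2,1)]
      using Bt SBv by (intro eq_vecI) auto
    finally have Mv: "riccati_M L t *\<^sub>v v = - (transpose_mat ?B *\<^sub>v (?S *\<^sub>v z))" .
    have BSz: "transpose_mat ?B *\<^sub>v (?S *\<^sub>v z) \<in> carrier_vec ?m" using Bt SBv by simp
    have "riccati_K L t *\<^sub>v x = - (minv (riccati_M L t) *\<^sub>v (transpose_mat ?B *\<^sub>v (?S *\<^sub>v z)))"
      unfolding riccati_K_def z_def
      using assoc_mult_mat_vec[OF MBS A x] assoc_mult_mat_vec[OF MB Sc(1), of "?A *\<^sub>v x"]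
        assoc_mult_mat_vec[OF mM Bt, of "?S *\<^sub>v (?A *\<^sub>v x)"] A x Sc MBS
      by (subst uminus_mult_mat_vec) auto
    also have "\<dots> = v"
      using mult_uminus[OF mM BSz] Mv minv_mult_vec(2)[OF Mc iM v] by simp
    finally have Kx: "riccati_K L t *\<^sub>v x = v" .
    have "quad_form (riccati_N L t) x = z \<bullet> p"
      unfolding N quad_form_congruence[OF mY A x] unfolding quad_form_def p_def z_def ..
    then show ?thesis
      using complete_square[OF Sc Rc B z u v pS Rv] unfolding Kx riccati_M_def z_def by simp
  qed
  \<comment> \<open>At \<open>u = K_t x\<close> the \<open>M\<close> term vanishes and
    \<open>quad_form (riccati_N L t) x\<close> equals a sum of two nonnegative forms.\<close>
  have "0 \<le> quad_form (riccati_N L t) x" if x: "x \<in> carrier_vec ?k" for x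
  proof -
    have u: "riccati_K L t *\<^sub>v x \<in> carrier_vec ?m" using Kc x by simp
    have z: "?A *\<^sub>v x + ?B *\<^sub>v (riccati_K L t *\<^sub>v x) \<in> carrier_vec ?n" using A B x u by simp
    have "quad_form (riccati_M L t) (riccati_K L t *\<^sub>v x - riccati_K L t *\<^sub>v x) = 0"
      using u Mc by (simp add: quad_form_def)
    then show ?thesis
      using sq[OF x u] z u S pos_def_imp_semidef[OF R] unfolding pos_semidef_def by fastforce
  qed
  then show "pos_semidef ?k (riccati_N L t)" using Nsym unfolding pos_semidef_def by auto
qed

section \<open>Random vectors\<close>

lemma space_borel_vec [simp]: "space (borel_vec n) = carrier_vec n"
  by (simp add: borel_vec_def)

text \<open>Reduces vector measurability to real coordinates. The carrier condition belongs to it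
  because \<open>carrier_vec n\<close> is the whole space of \<open>borel_vec n\<close>; read
  backwards, it is the source of all dimension facts about random vectors.\<close>

lemma measurable_borel_vec_iff:
  "f \<in> measurable N (borel_vec n) \<longleftrightarrow>
     (\<forall>\<omega>\<in>space N. f \<omega> \<in> carrier_vec n) \<and> (\<forall>i<n. (\<lambda>\<omega>. vec_index (f \<omega>) i) \<in> borel_measurable N)"
proof (intro iffI conjI ballI allI impI)
  assume f: "f \<in> measurable N (borel_vec n)"
  then show "f \<omega> \<in> carrier_vec n" if "\<omega> \<in> space N" for \<omega>
    using measurable_space[OF f that] by simp
  have "(\<lambda>x. \<lambda>i\<in>{..<n}. vec_index x i) \<in> measurable (borel_vec n) (Pi\<^sub>M {..<n} (\<lambda>_. borel))"
    unfolding borel_vec_def by (rule measurable_vimage_algebra1) (auto simp: space_PiM)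
  then have *: "(\<lambda>\<omega>. \<lambda>i\<in>{..<n}. vec_index (f \<omega>) i) \<in> measurable N (Pi\<^sub>M {..<n} (\<lambda>_. borel))"
    using measurable_compose[OF f] by blast
  show "(\<lambda>\<omega>. vec_index (f \<omega>) i) \<in> borel_measurable N" if "i < n" for i
    using measurable_compose[OF * measurable_component_singleton[of i]] that by simp
next
  assume "(\<forall>\<omega>\<in>space N. f \<omega> \<in> carrier_vec n) \<and> (\<forall>i<n. (\<lambda>\<omega>. vec_index (f \<omega>) i) \<in> borel_measurable N)"
  then show "f \<in> measurable N (borel_vec n)"
    unfolding borel_vec_def by (intro measurable_vimage_algebra2 measurable_restrict) auto
qed

lemma measurable_borel_vecI:
  "(\<And>\<omega>. \<omega> \<in> space N \<Longrightarrow> f \<omega> \<in> carrier_vec n) \<Longrightarrow>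
   (\<And>i. i < n \<Longrightarrow> (\<lambda>\<omega>. vec_index (f \<omega>) i) \<in> borel_measurable N) \<Longrightarrow> f \<in> measurable N (borel_vec n)"
  by (simp add: measurable_borel_vec_iff)

lemma borel_vec_carrier: "f \<in> measurable N (borel_vec n) \<Longrightarrow> \<omega> \<in> space N \<Longrightarrow> f \<omega> \<in> carrier_vec n"
  by (simp add: measurable_borel_vec_iff)

lemma borel_vec_index:
  "f \<in> measurable N (borel_vec n) \<Longrightarrow> i < n \<Longrightarrow> (\<lambda>\<omega>. vec_index (f \<omega>) i) \<in> borel_measurable N"
  by (simp add: measurable_borel_vec_iff)

lemma measurable_borel_vec_const: "x \<in> carrier_vec n \<Longrightarrow> (\<lambda>_. x) \<in> measurable N (borel_vec n)"
  by (rule measurable_const) simp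

lemma measurable_borel_vec_add:
  assumes f: "f \<in> measurable N (borel_vec n)" and g: "g \<in> measurable N (borel_vec n)"
  shows "(\<lambda>\<omega>. f \<omega> + g \<omega>) \<in> measurable N (borel_vec n)"
proof (rule measurable_borel_vecI)
  fix i assume i: "i < n"
  have "(\<lambda>\<omega>. vec_index (f \<omega>) i + vec_index (g \<omega>) i) \<in> borel_measurable N"
    using borel_vec_index[OF f i] borel_vec_index[OF g i] by simp
  then show "(\<lambda>\<omega>. vec_index (f \<omega> + g \<omega>) i) \<in> borel_measurable N"
    using i carrier_vecD[OF borel_vec_carrier[OF g]] by (subst measurable_cong) auto
qed (use borel_vec_carrier[OF f] borel_vec_carrier[OF g] in auto)

lemma measurable_borel_vec_diff:
  assumes f: "f \<in> measurable N (borel_vec n)" and g: "g \<in> measurable N (borel_vec n)"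
  shows "(\<lambda>\<omega>. f \<omega> - g \<omega>) \<in> measurable N (borel_vec n)"
proof (rule measurable_borel_vecI)
  fix i assume i: "i < n"
  have "(\<lambda>\<omega>. vec_index (f \<omega>) i - vec_index (g \<omega>) i) \<in> borel_measurable N"
    using borel_vec_index[OF f i] borel_vec_index[OF g i] by simp
  then show "(\<lambda>\<omega>. vec_index (f \<omega> - g \<omega>) i) \<in> borel_measurable N"
    using i carrier_vecD[OF borel_vec_carrier[OF g]] by (subst measurable_cong) auto
qed (use borel_vec_carrier[OF f] borel_vec_carrier[OF g] in auto)

lemma index_mult_mat_vec_sum:
  fixes P :: rmat
  assumes "P \<in> carrier_mat m n" "x \<in> carrier_vec n" "i < m"
  shows "vec_index (P *\<^sub>v x) i = (\<Sum>j<n. P $$ (i, j) * vec_index x j)"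
  using assms by (auto simp: scalar_prod_def atLeast0LessThan)

lemma measurable_borel_vec_mult_mat:
  assumes P: "P \<in> carrier_mat m n" and f: "f \<in> measurable N (borel_vec n)"
  shows "(\<lambda>\<omega>. P *\<^sub>v f \<omega>) \<in> measurable N (borel_vec m)"
proof (rule measurable_borel_vecI)
  fix i assume i: "i < m"
  have "(\<lambda>\<omega>. \<Sum>j<n. P $$ (i, j) * vec_index (f \<omega>) j) \<in> borel_measurable N"
    using borel_vec_index[OF f] by (intro borel_measurable_sum borel_measurable_times) auto
  then show "(\<lambda>\<omega>. vec_index (P *\<^sub>v f \<omega>) i) \<in> borel_measurable N"
    using index_mult_mat_vec_sum[OF P borel_vec_carrier[OF f] i] by (subst measurable_cong) auto
qed (use borel_vec_carrier[OF f] P in auto)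

lemma measurable_borel_vec_append:
  assumes f: "f \<in> measurable N (borel_vec n)" and g: "g \<in> measurable N (borel_vec m)"
  shows "(\<lambda>\<omega>. f \<omega> @\<^sub>v g \<omega>) \<in> measurable N (borel_vec (n + m))"
proof (rule measurable_borel_vecI)
  fix i assume i: "i < n + m"
  have eq: "vec_index (f \<omega> @\<^sub>v g \<omega>) i = (if i < n then vec_index (f \<omega>) i else vec_index (g \<omega>) (i - n))"
    if "\<omega> \<in> space N" for \<omega>
    using borel_vec_carrier[OF f that] borel_vec_carrier[OF g that] i by auto
  have "(\<lambda>\<omega>. if i < n then vec_index (f \<omega>) i else vec_index (g \<omega>) (i - n)) \<in> borel_measurable N"
    using borel_vec_index[OF f, of i] borel_vec_index[OF g, of "i - n"] i by (cases "i < n") auto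
  then show "(\<lambda>\<omega>. vec_index (f \<omega> @\<^sub>v g \<omega>) i) \<in> borel_measurable N"
    by (subst measurable_cong[OF eq])
qed (use borel_vec_carrier[OF f] borel_vec_carrier[OF g] in auto)

lemma measurable_quad_form:
  assumes P: "P \<in> carrier_mat n n" and f: "f \<in> measurable N (borel_vec n)"
  shows "(\<lambda>\<omega>. quad_form P (f \<omega>)) \<in> borel_measurable N"
proof -
  have "(\<lambda>\<omega>. \<Sum>i<n. \<Sum>j<n. P $$ (i, j) * (vec_index (f \<omega>) i * vec_index (f \<omega>) j)) \<in> borel_measurable N"
    using borel_vec_index[OF f] by (intro borel_measurable_sum borel_measurable_times) auto
  then show ?thesis
    using quad_form_eq_sum[OF P borel_vec_carrier[OF f]] by (subst measurable_cong) auto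
qed

text \<open>Needed twice: to turn a control known as a function of the sample point into a function
  of the history, and to factor expectations of products of independent quantities.\<close>

lemma Doob_Dynkin_real:
  fixes f :: "'a \<Rightarrow> real"
  assumes X: "X \<in> \<Omega> \<rightarrow> space N" and f: "f \<in> borel_measurable (vimage_algebra \<Omega> X N)"
  obtains g where "g \<in> borel_measurable N" "\<And>\<omega>. \<omega> \<in> \<Omega> \<Longrightarrow> f \<omega> = g (X \<omega>)"
proof -
  have "\<exists>A\<in>sets N. {\<omega>\<in>\<Omega>. f \<omega> \<le> real_of_rat q} = X -` A \<inter> \<Omega>" for q
  proof -
    have "{\<omega>\<in>space (vimage_algebra \<Omega> X N). f \<omega> \<le> real_of_rat q} \<in> sets (vimage_algebra \<Omega> X N)"
      using f by measurable
    then show ?thesis using sets_vimage_algebra2[OF X] by auto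
  qed
  then obtain A where A: "\<And>q. A q \<in> sets N" "\<And>q. {\<omega>\<in>\<Omega>. f \<omega> \<le> real_of_rat q} = X -` A q \<inter> \<Omega>"
    by metis
  \<comment> \<open>\<open>f\<close> is recovered as the infimum of the rational levels it does not
    exceed; countably many levels keep \<open>g\<close> measurable. Off the image of
    \<open>X\<close> the sets \<open>A q\<close> are uncontrolled and the infimum may be infinite,
    hence \<open>ereal\<close> here and \<open>real_of_ereal\<close> at the end.\<close>
  define g where "g h = (INF q. if h \<in> A q then ereal (real_of_rat q) else \<infinity>)" for h
  have "g \<in> borel_measurable N"
    unfolding g_def using A(1) by measurable
  moreover have "g (X \<omega>) = ereal (f \<omega>)" if \<omega>: "\<omega> \<in> \<Omega>" for \<omega>
  proof -
    have iff: "X \<omega> \<in> A q \<longleftrightarrow> f \<omega> \<le> real_of_rat q" for q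
      using A(2)[of q] \<omega> by auto
    show ?thesis
    proof (rule antisym)
      show "ereal (f \<omega>) \<le> g (X \<omega>)"
        unfolding g_def by (rule INF_greatest) (auto simp: iff)
      show "g (X \<omega>) \<le> ereal (f \<omega>)"
      proof (rule ereal_le_epsilon2)
        fix e :: real assume "0 < e"
        then obtain q where "f \<omega> < real_of_rat q" "real_of_rat q < f \<omega> + e"
          using of_rat_dense[of "f \<omega>" "f \<omega> + e"] by auto
        then show "g (X \<omega>) \<le> ereal (f \<omega>) + ereal e"
          unfolding g_def by (intro INF_lower2[of q]) (auto simp: iff)
      qed
    qed
  qed
  ultimately show ?thesis
    by (intro that[of "\<lambda>h. real_of_ereal (g h)"]) auto
qed

text \<open>Membership in L^2, put by coordinates so that products of two coordinates are
  integrable. The class is stable under sums, constant matrices and conditional expectation, the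
  operations from which the closed loop is built.\<close>

definition square_integrable_vec :: "'w measure \<Rightarrow> nat \<Rightarrow> ('w \<Rightarrow> rvec) \<Rightarrow> bool" where
  "square_integrable_vec M n X \<longleftrightarrow>
     X \<in> measurable M (borel_vec n) \<and> (\<forall>i<n. integrable M (\<lambda>\<omega>. (vec_index (X \<omega>) i)\<^sup>2))"

lemma square_integrable_vec_measurable: "square_integrable_vec M n X \<Longrightarrow> X \<in> measurable M (borel_vec n)"
  by (simp add: square_integrable_vec_def)

lemma integrable_mult_square:
  fixes f g :: "'a \<Rightarrow> real"
  assumes [measurable]: "f \<in> borel_measurable M" "g \<in> borel_measurable M"
    and "integrable M (\<lambda>x. (f x)\<^sup>2)" "integrable M (\<lambda>x. (g x)\<^sup>2)"
  shows "integrable M (\<lambda>x. f x * g x)"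
proof (rule Bochner_Integration.integrable_bound)
  show "integrable M (\<lambda>x. (f x)\<^sup>2 + (g x)\<^sup>2)" using assms by simp
  have "\<bar>a * b\<bar> \<le> a\<^sup>2 + b\<^sup>2" for a b :: real
    using sum_squares_bound[of "\<bar>a\<bar>" "\<bar>b\<bar>"] mult_nonneg_nonneg[OF abs_ge_zero abs_ge_zero, of a b]
    unfolding abs_mult power2_abs by linarith
  then show "AE x in M. norm (f x * g x) \<le> norm ((f x)\<^sup>2 + (g x)\<^sup>2)" by simp
qed simp

lemma integrable_square_add:
  fixes f g :: "'a \<Rightarrow> real"
  assumes "f \<in> borel_measurable M" "g \<in> borel_measurable M"
    and "integrable M (\<lambda>x. (f x)\<^sup>2)" "integrable M (\<lambda>x. (g x)\<^sup>2)"
  shows "integrable M (\<lambda>x. (f x + g x)\<^sup>2)"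
  using integrable_mult_square[OF assms] assms(3,4) by (simp add: power2_sum mult.assoc)

lemma integrable_square_sum:
  fixes f :: "'i \<Rightarrow> 'a \<Rightarrow> real"
  assumes "finite I" "\<And>i. i \<in> I \<Longrightarrow> f i \<in> borel_measurable M"
    and "\<And>i. i \<in> I \<Longrightarrow> integrable M (\<lambda>x. (f i x)\<^sup>2)"
  shows "integrable M (\<lambda>x. (\<Sum>i\<in>I. f i x)\<^sup>2)"
  using assms by (induction I rule: finite_induct) (auto intro!: integrable_square_add)

lemma square_integrable_vec_prod:
  assumes "square_integrable_vec M n X" "square_integrable_vec M m Y" "i < n" "j < m"
  shows "integrable M (\<lambda>\<omega>. vec_index (X \<omega>) i * vec_index (Y \<omega>) j)"
  using assms unfolding square_integrable_vec_def
  by (intro integrable_mult_square) (auto intro: borel_vec_index)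

lemma square_integrable_vec_add:
  assumes "square_integrable_vec M n X" "square_integrable_vec M n Y"
  shows "square_integrable_vec M n (\<lambda>\<omega>. X \<omega> + Y \<omega>)"
  unfolding square_integrable_vec_def
proof (intro conjI allI impI)
  have m: "X \<in> measurable M (borel_vec n)" "Y \<in> measurable M (borel_vec n)"
    using assms square_integrable_vec_measurable by auto
  then show "(\<lambda>\<omega>. X \<omega> + Y \<omega>) \<in> measurable M (borel_vec n)"
    by (rule measurable_borel_vec_add)
  fix i assume i: "i < n"
  have "integrable M (\<lambda>\<omega>. (vec_index (X \<omega>) i + vec_index (Y \<omega>) i)\<^sup>2)"
    using assms i unfolding square_integrable_vec_def
    by (intro integrable_square_add) (auto intro: borel_vec_index)
  then show "integrable M (\<lambda>\<omega>. (vec_index (X \<omega> + Y \<omega>) i)\<^sup>2)"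
    using i carrier_vecD[OF borel_vec_carrier[OF m(2)]] by (subst Bochner_Integration.integrable_cong[OF refl]) auto
qed

lemma square_integrable_vec_mult_mat:
  assumes P: "P \<in> carrier_mat m n" and X: "square_integrable_vec M n X"
  shows "square_integrable_vec M m (\<lambda>\<omega>. P *\<^sub>v X \<omega>)"
  unfolding square_integrable_vec_def
proof (intro conjI allI impI)
  note mX = square_integrable_vec_measurable[OF X]
  show "(\<lambda>\<omega>. P *\<^sub>v X \<omega>) \<in> measurable M (borel_vec m)"
    by (rule measurable_borel_vec_mult_mat[OF P mX])
  fix i assume i: "i < m"
  have "integrable M (\<lambda>\<omega>. (\<Sum>j<n. P $$ (i, j) * vec_index (X \<omega>) j)\<^sup>2)"
    using X unfolding square_integrable_vec_def
    by (intro integrable_square_sum) (auto intro!: borel_measurable_times borel_vec_index simp: power_mult_distrib)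
  then show "integrable M (\<lambda>\<omega>. (vec_index (P *\<^sub>v X \<omega>) i)\<^sup>2)"
    using index_mult_mat_vec_sum[OF P borel_vec_carrier[OF mX] i]
    by (subst Bochner_Integration.integrable_cong[OF refl]) auto
qed

lemma square_integrable_vec_diff:
  assumes X: "square_integrable_vec M n X" and Y: "square_integrable_vec M n Y"
  shows "square_integrable_vec M n (\<lambda>\<omega>. X \<omega> - Y \<omega>)"
  unfolding square_integrable_vec_def
proof (intro conjI allI impI)
  note m = square_integrable_vec_measurable[OF X] square_integrable_vec_measurable[OF Y]
  show "(\<lambda>\<omega>. X \<omega> - Y \<omega>) \<in> measurable M (borel_vec n)"
    by (rule measurable_borel_vec_diff[OF m])
  fix i assume i: "i < n"
  have "integrable M (\<lambda>\<omega>. (vec_index (X \<omega>) i + - vec_index (Y \<omega>) i)\<^sup>2)"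
    using X Y i unfolding square_integrable_vec_def
    by (intro integrable_square_add) (auto intro: borel_vec_index)
  then show "integrable M (\<lambda>\<omega>. (vec_index (X \<omega> - Y \<omega>) i)\<^sup>2)"
    using i carrier_vecD[OF borel_vec_carrier[OF m(2)]] by (subst Bochner_Integration.integrable_cong[OF refl]) auto
qed

lemma square_integrable_vec_cong_AE:
  assumes X: "X \<in> measurable M (borel_vec n)" and Y: "square_integrable_vec M n Y"
    and eq: "AE \<omega> in M. X \<omega> = Y \<omega>"
  shows "square_integrable_vec M n X"
  unfolding square_integrable_vec_def
proof (intro conjI allI impI X)
  fix i assume i: "i < n"
  note m = borel_vec_index[OF X i] borel_vec_index[OF square_integrable_vec_measurable[OF Y] i]
  show "integrable M (\<lambda>\<omega>. (vec_index (X \<omega>) i)\<^sup>2)"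
    using Y i eq m unfolding square_integrable_vec_def
    by (subst integrable_cong_AE[where g = "\<lambda>\<omega>. (vec_index (Y \<omega>) i)\<^sup>2"]) auto
qed

lemma (in finite_measure) square_integrable_vec_index:
  assumes "square_integrable_vec M n X" "i < n"
  shows "integrable M (\<lambda>\<omega>. vec_index (X \<omega>) i)"
  using square_integrable_imp_integrable[OF borel_vec_index[OF square_integrable_vec_measurable]] assms
  unfolding square_integrable_vec_def by blast

text \<open>Everything is reduced to mixed second moments of coordinates, the form in which both
  orthogonality and the error covariance are available.\<close>

lemma integral_bilinear:
  assumes X: "square_integrable_vec M m X" and Y: "square_integrable_vec M n Y" and P: "P \<in> carrier_mat m n"
  shows "integrable M (\<lambda>\<omega>. X \<omega> \<bullet> (P *\<^sub>v Y \<omega>))"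
    and "(\<integral>\<omega>. X \<omega> \<bullet> (P *\<^sub>v Y \<omega>) \<partial>M)
      = (\<Sum>i<m. \<Sum>j<n. P $$ (i, j) * (\<integral>\<omega>. vec_index (X \<omega>) i * vec_index (Y \<omega>) j \<partial>M))"
proof -
  have eq: "X \<omega> \<bullet> (P *\<^sub>v Y \<omega>) = (\<Sum>i<m. \<Sum>j<n. P $$ (i, j) * (vec_index (X \<omega>) i * vec_index (Y \<omega>) j))"
    if "\<omega> \<in> space M" for \<omega>
    using borel_vec_carrier[OF square_integrable_vec_measurable[OF X] that] P
      borel_vec_carrier[OF square_integrable_vec_measurable[OF Y] that]
    by (auto simp: scalar_prod_def atLeast0LessThan sum_distrib_left ac_simps intro!: sum.cong)
  note int = square_integrable_vec_prod[OF X Y]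
  show "integrable M (\<lambda>\<omega>. X \<omega> \<bullet> (P *\<^sub>v Y \<omega>))"
    by (subst Bochner_Integration.integrable_cong[OF refl eq]) (auto intro!: Bochner_Integration.integrable_sum integrable_mult_right int simp: int)
  show "(\<integral>\<omega>. X \<omega> \<bullet> (P *\<^sub>v Y \<omega>) \<partial>M)
      = (\<Sum>i<m. \<Sum>j<n. P $$ (i, j) * (\<integral>\<omega>. vec_index (X \<omega>) i * vec_index (Y \<omega>) j \<partial>M))"
  proof -
    have "(\<integral>\<omega>. X \<omega> \<bullet> (P *\<^sub>v Y \<omega>) \<partial>M)
      = (\<integral>\<omega>. (\<Sum>i<m. \<Sum>j<n. P $$ (i, j) * (vec_index (X \<omega>) i * vec_index (Y \<omega>) j)) \<partial>M)"
      using eq by (rule Bochner_Integration.integral_cong[OF refl])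
    also have "\<dots> = (\<Sum>i<m. (\<integral>\<omega>. (\<Sum>j<n. P $$ (i, j) * (vec_index (X \<omega>) i * vec_index (Y \<omega>) j)) \<partial>M))"
      by (rule Bochner_Integration.integral_sum) (auto intro!: Bochner_Integration.integrable_sum int)
    also have "\<dots> = (\<Sum>i<m. \<Sum>j<n. (\<integral>\<omega>. P $$ (i, j) * (vec_index (X \<omega>) i * vec_index (Y \<omega>) j) \<partial>M))"
      by (intro sum.cong refl Bochner_Integration.integral_sum) (auto intro!: int)
    finally show ?thesis by simp
  qed
qed

lemma integrable_quad_form:
  assumes "square_integrable_vec M n X" "P \<in> carrier_mat n n"
  shows "integrable M (\<lambda>\<omega>. quad_form P (X \<omega>))"
  unfolding quad_form_def using integral_bilinear(1)[OF assms(1,1,2)] .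

text \<open>Pythagoras. Orthogonality is asked of all pairs of coordinates, so the identity holds in
  the norm of any symmetric \<open>P\<close>. It is used to split off the process noise and to
  separate regret from estimation error.\<close>

lemma integral_quad_form_add:
  assumes X: "square_integrable_vec M n X" and Y: "square_integrable_vec M n Y"
    and P: "P \<in> carrier_mat n n" "transpose_mat P = P"
    and orth: "\<And>i j. i < n \<Longrightarrow> j < n \<Longrightarrow> (\<integral>\<omega>. vec_index (X \<omega>) i * vec_index (Y \<omega>) j \<partial>M) = 0"
  shows "(\<integral>\<omega>. quad_form P (X \<omega> + Y \<omega>) \<partial>M) = (\<integral>\<omega>. quad_form P (X \<omega>) \<partial>M) + (\<integral>\<omega>. quad_form P (Y \<omega>) \<partial>M)"
proof -
  note c = borel_vec_carrier[OF square_integrable_vec_measurable]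
  have "(\<integral>\<omega>. quad_form P (X \<omega> + Y \<omega>) \<partial>M)
      = (\<integral>\<omega>. quad_form P (X \<omega>) + 2 * (X \<omega> \<bullet> (P *\<^sub>v Y \<omega>)) + quad_form P (Y \<omega>) \<partial>M)"
    using quad_form_add_vec[OF P c[OF X] c[OF Y]] scalar_prod_symmetric_mult[OF P c[OF X] c[OF Y]]
    by (intro Bochner_Integration.integral_cong) auto
  also have "\<dots> = (\<integral>\<omega>. quad_form P (X \<omega>) \<partial>M) + (\<integral>\<omega>. quad_form P (Y \<omega>) \<partial>M)"
    using integrable_quad_form[OF X P(1)] integrable_quad_form[OF Y P(1)] integral_bilinear[OF X Y P(1)] orth
    by simp
  finally show ?thesis .
qed

lemma normal_law_moments:
  assumes "0 \<le> s2"
  shows "sets (normal_law m s2) = sets borel" "integrable (normal_law m s2) (\<lambda>x. x\<^sup>2)"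
    "(\<integral>x. x \<partial>normal_law m s2) = m"
proof -
  show "sets (normal_law m s2) = sets borel" by (simp add: normal_law_def)
  let ?d = "normal_density m (sqrt s2)"
  have pos: "0 < sqrt s2" if "s2 \<noteq> 0" using assms that by simp
  \<comment> \<open>Expresses the raw second moment through the central one, the mean and the total
    mass.\<close>
  have "?d x * x\<^sup>2 = ?d x * (x - m)^2 + 2 * m * (?d x * x) - m\<^sup>2 * ?d x" for x
    by (simp add: power2_eq_square algebra_simps)
  then have "integrable lborel (\<lambda>x. ?d x * x\<^sup>2)" if "s2 \<noteq> 0"
    using integrable_normal_moment[OF pos[OF that], of m 2] integrable_normal_moment_nz_1[OF pos[OF that], of m]
      integrable_normal_density[OF pos[OF that], of m] by simp
  then show "integrable (normal_law m s2) (\<lambda>x. x\<^sup>2)"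
    by (cases "s2 = 0") (simp_all add: normal_law_def integrable_density, simp add: integrable_iff_bounded nn_integral_return)
  show "(\<integral>x. x \<partial>normal_law m s2) = m"
    using integral_normal_moment_nz_1[OF pos, of m]
    by (auto simp: normal_law_def integral_return integral_density)
qed

text \<open>\<open>gaussian\<close> constrains the laws of linear functionals; testing it with unit
  vectors gives the laws of the coordinates.\<close>

lemma gaussian_moments:
  assumes g: "gaussian M n X m \<Sigma>"
  shows gaussian_square_integrable: "square_integrable_vec M n X"
    and gaussian_mean: "\<And>i. i < n \<Longrightarrow> (\<integral>\<omega>. vec_index (X \<omega>) i \<partial>M) = vec_index m i"
proof -
  have X: "X \<in> measurable M (borel_vec n)" and m: "m \<in> carrier_vec n" and S: "pos_semidef n \<Sigma>"
    using g unfolding gaussian_def by auto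
  have *: "integrable M (\<lambda>\<omega>. (vec_index (X \<omega>) i)\<^sup>2)" "(\<integral>\<omega>. vec_index (X \<omega>) i \<partial>M) = vec_index m i"
    if i: "i < n" for i
  proof -
    note Xi = borel_vec_index[OF X i]
    have eq: "unit_vec n i \<bullet> x = vec_index x i" if "x \<in> carrier_vec n" for x :: rvec
      using i that by simp
    have "distr M borel (\<lambda>\<omega>. vec_index (X \<omega>) i) = distr M borel (\<lambda>\<omega>. unit_vec n i \<bullet> X \<omega>)"
      using eq borel_vec_carrier[OF X] by (intro distr_cong) auto
    also have "\<dots> = normal_law (vec_index m i) (quad_form \<Sigma> (unit_vec n i))"
      using g eq[OF m] unfolding gaussian_def by simp
    finally have law: "distr M borel (\<lambda>\<omega>. vec_index (X \<omega>) i)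
      = normal_law (vec_index m i) (quad_form \<Sigma> (unit_vec n i))" .
    have "0 \<le> quad_form \<Sigma> (unit_vec n i)" using S unfolding pos_semidef_def by simp
    note mom = normal_law_moments[OF this, of "vec_index m i", folded law]
    show "integrable M (\<lambda>\<omega>. (vec_index (X \<omega>) i)\<^sup>2)"
      using mom(2) Xi by (simp add: integrable_distr_eq)
    show "(\<integral>\<omega>. vec_index (X \<omega>) i \<partial>M) = vec_index m i"
      using mom(3) Xi by (simp add: integral_distr)
  qed
  show "square_integrable_vec M n X" using X * unfolding square_integrable_vec_def by auto
  show "\<And>i. i < n \<Longrightarrow> (\<integral>\<omega>. vec_index (X \<omega>) i \<partial>M) = vec_index m i" using * by auto
qed

section \<open>Conditional expectations of random vectors\<close>

text \<open>The shape of \<open>estimate\<close>, freed from the control problem so that projection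
  properties can be proved over any probability space. Its values lie in the carrier at every sample
  point, not just almost everywhere.\<close>

definition cond_exp_vec :: "'w measure \<Rightarrow> 'w measure \<Rightarrow> nat \<Rightarrow> ('w \<Rightarrow> rvec) \<Rightarrow> 'w \<Rightarrow> rvec" where
  "cond_exp_vec M F n X \<omega> = Matrix.vec n (\<lambda>i. real_cond_exp M F (\<lambda>\<omega>'. vec_index (X \<omega>') i) \<omega>)"

lemma measurable_cond_exp_vec: "cond_exp_vec M F n X \<in> measurable F (borel_vec n)"
  by (rule measurable_borel_vecI) (simp_all add: cond_exp_vec_def)

lemma measurable_cond_exp_vec2: "cond_exp_vec M F n X \<in> measurable M (borel_vec n)"
  by (rule measurable_borel_vecI) (simp_all add: cond_exp_vec_def)

context prob_space
begin

lemma subalgebra_sigma_finite: "subalgebra M F \<Longrightarrow> sigma_finite_subalgebra M F"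
  by (intro finite_measure_subalgebra_is_sigma_finite finite_measure_subalgebra.intro
      finite_measure_axioms finite_measure_subalgebra_axioms.intro)

text \<open>Conditional Jensen for the square function. The library rule works on an interval; on
  the whole line the endpoints \<open>a\<close> and \<open>b\<close> are placeholders.\<close>

lemma square_integrable_cond_exp_vec:
  assumes F: "subalgebra M F" and X: "square_integrable_vec M n X"
  shows "square_integrable_vec M n (cond_exp_vec M F n X)"
proof -
  interpret F: sigma_finite_subalgebra M F by (rule subalgebra_sigma_finite[OF F])
  show ?thesis
    unfolding square_integrable_vec_def
  proof (intro conjI allI impI measurable_cond_exp_vec2)
    fix i assume i: "i < n"
    have "integrable M (\<lambda>\<omega>. (real_cond_exp M F (\<lambda>\<omega>'. vec_index (X \<omega>') i) \<omega>)\<^sup>2)"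
    proof (rule F.integrable_convex_cond_exp[where I = UNIV and a = 0 and b = 0, OF square_integrable_vec_index[OF X i]])
      show "integrable M (\<lambda>\<omega>. (vec_index (X \<omega>) i)\<^sup>2)"
        using X i unfolding square_integrable_vec_def by blast
      show "convex_on UNIV (\<lambda>x::real. x\<^sup>2)" by (rule convex_power2)
      show "(\<lambda>x::real. x\<^sup>2) \<in> borel_measurable borel" by measurable
      show "AE \<omega> in M. vec_index (X \<omega>) i \<in> UNIV" by (rule AE_I2) (rule UNIV_I)
      show "UNIV = {0<..<0::real} \<or> UNIV = {0::real<..} \<or> UNIV = {..<0::real} \<or> (UNIV::real set) = UNIV"
        by (intro disjI2 refl)
      show "0 \<in> (UNIV::real set)" by (rule UNIV_I)
    qed
    then show "integrable M (\<lambda>\<omega>. (vec_index (cond_exp_vec M F n X \<omega>) i)\<^sup>2)"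
      using i by (simp only: cond_exp_vec_def index_vec)
  qed
qed

text \<open>The factor known to \<open>F\<close> moves inside the conditional expectation, so
  multiplying by it gives the same integral for \<open>X\<close> and for its projection.\<close>

lemma cond_exp_vec_orthogonal:
  assumes F: "subalgebra M F" and X: "square_integrable_vec M n X" and Y: "square_integrable_vec M m Y"
    and YF: "Y \<in> measurable F (borel_vec m)" and i: "i < m" and j: "j < n"
  shows "(\<integral>\<omega>. vec_index (Y \<omega>) i * vec_index (cond_exp_vec M F n X \<omega> - X \<omega>) j \<partial>M) = 0"
proof -
  interpret F: sigma_finite_subalgebra M F by (rule subalgebra_sigma_finite[OF F])
  let ?E = "real_cond_exp M F (\<lambda>\<omega>'. vec_index (X \<omega>') j)"
  note Xm = square_integrable_vec_measurable[OF X]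
  note E = F.real_cond_exp_intg[OF square_integrable_vec_prod[OF Y X i j] borel_vec_index[OF YF i] borel_vec_index[OF Xm j]]
  have "(\<integral>\<omega>. vec_index (Y \<omega>) i * vec_index (cond_exp_vec M F n X \<omega> - X \<omega>) j \<partial>M)
    = (\<integral>\<omega>. vec_index (Y \<omega>) i * ?E \<omega> - vec_index (Y \<omega>) i * vec_index (X \<omega>) j \<partial>M)"
    using j carrier_vecD[OF borel_vec_carrier[OF Xm]]
    by (intro Bochner_Integration.integral_cong) (auto simp: cond_exp_vec_def algebra_simps)
  also have "\<dots> = 0"
    using E square_integrable_vec_prod[OF Y X i j] by simp
  finally show ?thesis .
qed

lemma cond_exp_vec_cong:
  assumes F: "subalgebra M F" and X: "X \<in> measurable M (borel_vec n)" and Y: "Y \<in> measurable M (borel_vec n)"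
    and eq: "\<And>\<omega>. \<omega> \<in> space M \<Longrightarrow> X \<omega> = Y \<omega>"
  shows "AE \<omega> in M. cond_exp_vec M F n X \<omega> = cond_exp_vec M F n Y \<omega>"
proof -
  interpret F: sigma_finite_subalgebra M F by (rule subalgebra_sigma_finite[OF F])
  have "AE \<omega> in M. \<forall>i\<in>{..<n}. real_cond_exp M F (\<lambda>\<omega>'. vec_index (X \<omega>') i) \<omega>
      = real_cond_exp M F (\<lambda>\<omega>'. vec_index (Y \<omega>') i) \<omega>"
    using eq borel_vec_index[OF X] borel_vec_index[OF Y]
    by (intro AE_finite_allI F.real_cond_exp_cong AE_I2) auto
  then show ?thesis
    by eventually_elim (auto simp: cond_exp_vec_def)
qed

text \<open>Applied later with \<open>Y\<close> the difference of the states under two policies, a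
  quantity known to the observer.\<close>

lemma cond_exp_vec_add_measurable:
  assumes F: "subalgebra M F" and X: "square_integrable_vec M n X" and Y: "square_integrable_vec M n Y"
    and YF: "Y \<in> measurable F (borel_vec n)"
  shows "AE \<omega> in M. cond_exp_vec M F n (\<lambda>\<omega>. X \<omega> + Y \<omega>) \<omega> = cond_exp_vec M F n X \<omega> + Y \<omega>"
proof -
  interpret F: sigma_finite_subalgebra M F by (rule subalgebra_sigma_finite[OF F])
  note XY = square_integrable_vec_measurable[OF X] square_integrable_vec_measurable[OF Y]
  have "AE \<omega> in M. \<forall>i\<in>{..<n}. real_cond_exp M F (\<lambda>\<omega>'. vec_index (X \<omega>' + Y \<omega>') i) \<omega>
      = real_cond_exp M F (\<lambda>\<omega>'. vec_index (X \<omega>') i) \<omega> + vec_index (Y \<omega>) i"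
  proof (rule AE_finite_allI)
    fix i assume "i \<in> {..<n}"
    then have i: "i < n" by simp
    note int = square_integrable_vec_index[OF X i] square_integrable_vec_index[OF Y i]
    have "AE \<omega> in M. real_cond_exp M F (\<lambda>\<omega>'. vec_index (X \<omega>' + Y \<omega>') i) \<omega>
      = real_cond_exp M F (\<lambda>\<omega>'. vec_index (X \<omega>') i + vec_index (Y \<omega>') i) \<omega>"
      using i carrier_vecD[OF borel_vec_carrier[OF XY(2)]] borel_vec_index[OF measurable_borel_vec_add[OF XY] i]
        borel_vec_index[OF XY(1) i] borel_vec_index[OF XY(2) i]
      by (intro F.real_cond_exp_cong AE_I2) auto
    moreover note F.real_cond_exp_add[OF int] F.real_cond_exp_F_meas[OF int(2) borel_vec_index[OF YF i]]
    ultimately show "AE \<omega> in M. real_cond_exp M F (\<lambda>\<omega>'. vec_index (X \<omega>' + Y \<omega>') i) \<omega>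
      = real_cond_exp M F (\<lambda>\<omega>'. vec_index (X \<omega>') i) \<omega> + vec_index (Y \<omega>) i"
      by eventually_elim simp
  qed simp
  then show ?thesis
    using AE_space
  proof eventually_elim
    case (elim \<omega>)
    have "dim_vec (Y \<omega>) = n" using borel_vec_carrier[OF XY(2) elim(2)] by simp
    then show ?case
      using elim(1) by (intro eq_vecI) (simp_all only: cond_exp_vec_def dim_vec index_vec index_add_vec lessThan_iff)
  qed
qed

text \<open>By Doob-Dynkin, \<open>f\<close> and \<open>g\<close> need only be measurable for the
  generated algebras; they never have to be displayed as functions of \<open>X\<close> and
  \<open>Y\<close>. This suits closed-loop quantities, which depend on the noises through a
  recursion.\<close>

lemma integral_mult_indep:
  fixes f g :: "'a \<Rightarrow> real"
  assumes ind: "indep_var N X N' Y"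
    and f: "integrable M f" "f \<in> borel_measurable (vimage_algebra (space M) X N)"
    and g: "integrable M g" "g \<in> borel_measurable (vimage_algebra (space M) Y N')"
  shows "(\<integral>\<omega>. f \<omega> * g \<omega> \<partial>M) = (\<integral>\<omega>. f \<omega> \<partial>M) * (\<integral>\<omega>. g \<omega> \<partial>M)"
proof -
  have X: "X \<in> space M \<rightarrow> space N" and Y: "Y \<in> space M \<rightarrow> space N'"
    using indep_var_rv1[OF ind] indep_var_rv2[OF ind] by (auto dest: measurable_space)
  obtain f' where f': "f' \<in> borel_measurable N" "\<And>\<omega>. \<omega> \<in> space M \<Longrightarrow> f \<omega> = f' (X \<omega>)"
    by (rule Doob_Dynkin_real[OF X f(2)]) auto
  obtain g' where g': "g' \<in> borel_measurable N'" "\<And>\<omega>. \<omega> \<in> space M \<Longrightarrow> g \<omega> = g' (Y \<omega>)"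
    by (rule Doob_Dynkin_real[OF Y g(2)]) auto
  have "integrable M (f' \<circ> X)" "integrable M (g' \<circ> Y)"
    using Bochner_Integration.integrable_cong[OF refl, of M f "f' \<circ> X"]
      Bochner_Integration.integrable_cong[OF refl, of M g "g' \<circ> Y"] f(1) g(1) f'(2) g'(2) by auto
  from indep_var_lebesgue_integral[OF indep_var_compose[OF ind f'(1) g'(1)] this]
  have "(\<integral>\<omega>. f' (X \<omega>) * g' (Y \<omega>) \<partial>M) = (\<integral>\<omega>. f' (X \<omega>) \<partial>M) * (\<integral>\<omega>. g' (Y \<omega>) \<partial>M)"
    by simp
  moreover have "(\<integral>\<omega>. f \<omega> * g \<omega> \<partial>M) = (\<integral>\<omega>. f' (X \<omega>) * g' (Y \<omega>) \<partial>M)"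
    "(\<integral>\<omega>. f \<omega> \<partial>M) = (\<integral>\<omega>. f' (X \<omega>) \<partial>M)" "(\<integral>\<omega>. g \<omega> \<partial>M) = (\<integral>\<omega>. g' (Y \<omega>) \<partial>M)"
    using f'(2) g'(2) by (auto intro!: Bochner_Integration.integral_cong)
  ultimately show ?thesis by simp
qed

end

section \<open>The closed loop\<close>

lemma vNil_carrier: "(vNil :: rvec) \<in> carrier_vec 0"
  by simp

lemma stack_carrier:
  fixes f :: "'i \<Rightarrow> rvec"
  shows "(\<And>i. i \<in> set is \<Longrightarrow> f i \<in> carrier_vec (d i)) \<Longrightarrow>
    foldr (@\<^sub>v) (map f is) vNil \<in> carrier_vec (sum_list (map d is))"
  by (induction "is") (auto simp: vNil_carrier)

lemma measurable_stack:
  fixes f :: "'i \<Rightarrow> 'w \<Rightarrow> rvec"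
  shows "(\<And>i. i \<in> set is \<Longrightarrow> f i \<in> measurable N (borel_vec (d i))) \<Longrightarrow>
    (\<lambda>\<omega>. foldr (@\<^sub>v) (map (\<lambda>i. f i \<omega>) is) vNil) \<in> measurable N (borel_vec (sum_list (map d is)))"
  by (induction "is") (auto simp: vNil_carrier measurable_borel_vec_const intro!: measurable_borel_vec_append)

text \<open>Lets the shift that a change of control causes at each sensor be collected into a shift
  of the stacked measurement.\<close>

lemma stack_add:
  fixes f g :: "'i \<Rightarrow> rvec"
  shows "(\<And>i. i \<in> set is \<Longrightarrow> f i \<in> carrier_vec (d i)) \<Longrightarrow> (\<And>i. i \<in> set is \<Longrightarrow> g i \<in> carrier_vec (d i)) \<Longrightarrow>
    foldr (@\<^sub>v) (map (\<lambda>i. f i + g i) is) vNil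
      = foldr (@\<^sub>v) (map f is) vNil + foldr (@\<^sub>v) (map g is) vNil"
proof (induction "is")
  case Nil
  show ?case by (intro eq_vecI) auto
next
  case (Cons i "is")
  then have "f i \<in> carrier_vec (d i)" "g i \<in> carrier_vec (d i)"
    "foldr (@\<^sub>v) (map f is) vNil \<in> carrier_vec (sum_list (map d is))"
    "foldr (@\<^sub>v) (map g is) vNil \<in> carrier_vec (sum_list (map d is))"
    by (auto intro!: stack_carrier)
  from append_vec_add[OF this] Cons show ?case by simp
qed

section \<open>Causality of the closed loop\<close>

lemma state_initial: "state L S \<pi> (Suc 0) \<omega> = x_init L \<omega>"
  by (simp add: state.simps)

lemma state_Suc:
  "0 < t \<Longrightarrow> state L S \<pi> (Suc t) \<omega>
     = A_mat L t *\<^sub>v state L S \<pi> t \<omega> + B_mat L t *\<^sub>v control L S \<pi> t \<omega> + w_noise L t \<omega>"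
  by (simp add: state.simps[of L S \<pi> "Suc t"] control_def observations_def observation_def)

text \<open>Strong induction, since the state recurs on the entire past through the history handed
  to the policy. The inequality is strict: the control at time \<open>t\<close> first acts on the
  state at \<open>t + 1\<close>.\<close>

lemma state_cong:
  "(\<And>\<tau>. \<tau> < t \<Longrightarrow> \<pi> \<tau> = \<pi>' \<tau>) \<Longrightarrow> state L S \<pi> t \<omega> = state L S \<pi>' t \<omega>"
proof (induction t rule: less_induct)
  case (less t)
  show ?case
  proof (cases "t \<le> 1")
    case False
    have eq: "state L S \<pi> \<tau> \<omega> = state L S \<pi>' \<tau> \<omega>" if "\<tau> < t" for \<tau>
      using less that by auto
    then have "(\<lambda>\<tau>\<in>{1..t - 1}. stacked_output L S \<tau> (state L S \<pi> \<tau> \<omega>) \<omega>)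
        = (\<lambda>\<tau>\<in>{1..t - 1}. stacked_output L S \<tau> (state L S \<pi>' \<tau> \<omega>) \<omega>)"
      using False by (intro restrict_ext) auto
    moreover have "\<pi> (t - 1) = \<pi>' (t - 1)" using less(2) False by simp
    ultimately show ?thesis
      using False eq[of "t - 1"] by (simp add: state.simps[of L S _ t])
  qed (simp add: state.simps)
qed

lemma observations_cong:
  "(\<And>\<tau>. \<tau> < t \<Longrightarrow> \<pi> \<tau> = \<pi>' \<tau>) \<Longrightarrow> observations L S \<pi> t = observations L S \<pi>' t"
  unfolding observations_def observation_def
  by (intro ext restrict_ext arg_cong2[where f = "stacked_output L S _"] refl)
    (auto simp: fun_eq_iff restrict_def intro!: state_cong arg_cong2[where f = "stacked_output L S _"])

text \<open>The equality is literal, not merely almost everywhere: the conditioning algebra and the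
  conditioned function are the same terms for both policies.\<close>

lemma estimate_cong:
  assumes "\<And>\<tau>. \<tau> < t \<Longrightarrow> \<pi> \<tau> = \<pi>' \<tau>"
  shows "estimate L S \<pi> t = estimate L S \<pi>' t"
  unfolding estimate_def
  using observations_cong[OF assms, where L = L and S = S] state_cong[OF assms, where L = L and S = S]
  by simp

definition info_algebra :: "('w, 'i::linorder) lqg \<Rightarrow> 'i set \<Rightarrow> policy \<Rightarrow> nat \<Rightarrow> 'w measure" where
  "info_algebra L S \<pi> t =
     vimage_algebra (space (prob_measure L)) (observations L S \<pi> t) (history_algebra L S t)"

lemma estimate_eq_cond_exp_vec:
  "estimate L S \<pi> t = cond_exp_vec (prob_measure L) (info_algebra L S \<pi> t) (xdim L t) (state L S \<pi> t)"
  by (simp add: fun_eq_iff estimate_def cond_exp_vec_def info_algebra_def)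

section \<open>A fixed problem and its Riccati matrices\<close>

locale lqg_problem =
  fixes L :: "('w, 'i::linorder) lqg"
  assumes system: "lqg_system L" and invertible: "riccati_invertible L"
begin

abbreviation "P \<equiv> prob_measure L"
abbreviation "T \<equiv> horizon L"

sublocale prob_space P
  using system unfolding lqg_system_def by blast

lemma finite_sensors: "finite (sensors L)"
  using system unfolding lqg_system_def by blast

lemma step_matrices:
  assumes "t \<in> {1..T}"
  shows A_carrier: "A_mat L t \<in> carrier_mat (xdim L (Suc t)) (xdim L t)"
    and B_carrier: "B_mat L t \<in> carrier_mat (xdim L (Suc t)) (udim L t)"
    and C_carrier: "\<And>i. i \<in> sensors L \<Longrightarrow> C_mat L i t \<in> carrier_mat (ydim L i t) (xdim L t)"
    and Q_semidef: "pos_semidef (xdim L (Suc t)) (Q_mat L t)"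
    and R_pos_def: "pos_def (udim L t) (R_mat L t)"
  using system assms unfolding lqg_system_def by auto

lemma initial_square_integrable: "square_integrable_vec P (xdim L (Suc 0)) (x_init L)"
  using system unfolding lqg_system_def by (auto intro: gaussian_square_integrable)

lemma noise_square_integrable: "t \<in> {1..T} \<Longrightarrow> square_integrable_vec P (xdim L (Suc t)) (w_noise L t)"
  using system unfolding lqg_system_def by (auto intro: gaussian_square_integrable)

lemma noise_mean:
  assumes "t \<in> {1..T}" "i < xdim L (Suc t)"
  shows "(\<integral>\<omega>. vec_index (w_noise L t \<omega>) i \<partial>P) = 0"
proof -
  have "gaussian P (xdim L (Suc t)) (w_noise L t) (0\<^sub>v (xdim L (Suc t))) (W_cov L t)"
    using system assms unfolding lqg_system_def by auto
  from gaussian_mean[OF this assms(2)] assms(2) show ?thesis by simp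
qed

lemma measurement_noise_measurable:
  "t \<in> {1..T} \<Longrightarrow> i \<in> sensors L \<Longrightarrow> v_noise L i t \<in> measurable P (borel_vec (ydim L i t))"
  using system unfolding lqg_system_def gaussian_def by auto

text \<open>Downward induction from \<open>N\<close> at \<open>Suc T\<close>, which is zero:
  \<open>S_t\<close> inherits semidefiniteness from \<open>Q_t\<close> and \<open>N\<close> at
  \<open>Suc t\<close>, and \<open>riccati_step\<close> passes it on to \<open>N_t\<close>.\<close>

lemma riccati_S_semidef: "t \<in> {1..T} \<Longrightarrow> pos_semidef (xdim L (Suc t)) (riccati_S L t)"
  and cost_to_go_semidef: "t \<in> {1..Suc T} \<Longrightarrow> pos_semidef (xdim L t) (riccati_N L t)"
proof -
  have S: "pos_semidef (xdim L (Suc t)) (riccati_S L t)"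
    if "t \<in> {1..T}" "pos_semidef (xdim L (Suc t)) (riccati_N L (Suc t))" for t
    using pos_semidef_add[OF Q_semidef[OF that(1)] that(2)] by (simp add: riccati_S.simps)
  have N: "pos_semidef (xdim L t) (riccati_N L t)" if "t \<le> Suc T" "1 \<le> t" for t
    using that
  proof (induction t rule: inc_induct)
    case base
    then show ?case
      unfolding riccati_N_terminal
      by (auto simp: pos_semidef_def quad_form_eq_sum[of _ "xdim L (Suc T)"])
  next
    case (step t)
    then have t: "t \<in> {1..T}" by simp
    with step have "pos_semidef (xdim L (Suc t)) (riccati_N L (Suc t))" by simp
    from S[OF t this] show ?case
      by (rule riccati_N_semidef[OF t invertible A_carrier[OF t] B_carrier[OF t] R_pos_def[OF t]])
  qed
  show "t \<in> {1..T} \<Longrightarrow> pos_semidef (xdim L (Suc t)) (riccati_S L t)"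
    by (rule S) (auto intro: N)
  show "t \<in> {1..Suc T} \<Longrightarrow> pos_semidef (xdim L t) (riccati_N L t)"
    by (auto intro: N)
qed

text \<open>The facts plugged in each leave a premise \<open>t \<in> {1..T}\<close> behind, which
  explains the fivefold \<open>t\<close> in later instantiations.\<close>

lemmas riccati = riccati_step[OF _ invertible A_carrier B_carrier R_pos_def riccati_S_semidef]

lemma S_carrier: "t \<in> {1..T} \<Longrightarrow> riccati_S L t \<in> carrier_mat (xdim L (Suc t)) (xdim L (Suc t))"
  and S_symmetric: "t \<in> {1..T} \<Longrightarrow> transpose_mat (riccati_S L t) = riccati_S L t"
  using riccati_S_semidef[of t] by (auto simp: pos_semidef_def)

lemma M_carrier: "t \<in> {1..T} \<Longrightarrow> riccati_M L t \<in> carrier_mat (udim L t) (udim L t)"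
  and M_symmetric: "t \<in> {1..T} \<Longrightarrow> transpose_mat (riccati_M L t) = riccati_M L t"
  using riccati(1)[of t] by (auto simp: pos_def_def)

section \<open>Measurability and the information of the observer\<close>

lemma stack_dim: "S \<subseteq> sensors L \<Longrightarrow> sum_list (map d (sorted_list_of_set S)) = (\<Sum>i\<in>S. d i :: nat)"
  using finite_subset[OF _ finite_sensors, of S]
  by (simp add: sum_list_distinct_conv_sum_set)

text \<open>\<open>N\<close> is left open to serve two purposes: the full probability space, and the
  algebra generated by the sources preceding \<open>w_t\<close>. For the latter the time bounds
  matter: up to time \<open>t\<close> the loop uses measurement noise through \<open>t\<close> but
  process noise only before \<open>t\<close>.\<close>

lemma closed_loop_measurable:
  assumes S: "S \<subseteq> sensors L" and adm: "admissible L S \<pi>"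
    and init: "x_init L \<in> measurable N (borel_vec (xdim L (Suc 0)))"
    and w: "\<And>s. s \<in> {1..T} \<Longrightarrow> s < t \<Longrightarrow> w_noise L s \<in> measurable N (borel_vec (xdim L (Suc s)))"
    and v: "\<And>i s. i \<in> S \<Longrightarrow> s \<in> {1..T} \<Longrightarrow> s \<le> t \<Longrightarrow> v_noise L i s \<in> measurable N (borel_vec (ydim L i s))"
  shows "t \<in> {1..Suc T} \<Longrightarrow> state L S \<pi> t \<in> measurable N (borel_vec (xdim L t))"
    and "t \<in> {1..T} \<Longrightarrow> observations L S \<pi> t \<in> measurable N (history_algebra L S t)"
    and "t \<in> {1..T} \<Longrightarrow> control L S \<pi> t \<in> measurable N (borel_vec (udim L t))"
proof -
  have out: "observation L S \<pi> s \<in> measurable N (borel_vec (\<Sum>i\<in>S. ydim L i s))"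
    if "s \<in> {1..T}" "s \<le> t" "state L S \<pi> s \<in> measurable N (borel_vec (xdim L s))" for s
    unfolding observation_def stacked_output_def stack_dim[OF S, symmetric]
    using that S finite_subset[OF S finite_sensors]
    by (intro measurable_stack measurable_borel_vec_add[OF measurable_borel_vec_mult_mat[OF C_carrier]] v)
      auto
  have hist: "observations L S \<pi> s \<in> measurable N (history_algebra L S s)"
    if "s \<in> {1..T}" "s \<le> t" "\<And>r. r \<in> {1..s} \<Longrightarrow> state L S \<pi> r \<in> measurable N (borel_vec (xdim L r))" for s
    unfolding observations_def history_algebra_def using that
    by (intro measurable_restrict out) auto
  have ctrl: "control L S \<pi> s \<in> measurable N (borel_vec (udim L s))"
    if "s \<in> {1..T}" "s \<le> t" "\<And>r. r \<in> {1..s} \<Longrightarrow> state L S \<pi> r \<in> measurable N (borel_vec (xdim L r))" for s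
    unfolding control_def
    by (rule measurable_compose[OF hist]) (use that adm in \<open>auto simp: admissible_def\<close>)
  have state: "state L S \<pi> s \<in> measurable N (borel_vec (xdim L s))" if "s \<in> {1..Suc T}" "s \<le> t" for s
    using that
  proof (induction s rule: less_induct)
    case (less s)
    show ?case
    proof (cases "s = 1")
      case True
      then show ?thesis using init by (simp add: state_initial)
    next
      case False
      then obtain r where s: "s = Suc r" and r: "r \<in> {1..T}" "r < t" using less(2,3) by (cases s) auto
      have "state L S \<pi> r' \<in> measurable N (borel_vec (xdim L r'))" if "r' \<in> {1..r}" for r'
        using less that s by auto
      moreover from this have "state L S \<pi> r \<in> measurable N (borel_vec (xdim L r))" using r by simp
      ultimately have "(\<lambda>\<omega>. A_mat L r *\<^sub>v state L S \<pi> r \<omega> + B_mat L r *\<^sub>v control L S \<pi> r \<omega> + w_noise L r \<omega>)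
          \<in> measurable N (borel_vec (xdim L s))"
        unfolding s using r
        by (intro measurable_borel_vec_add measurable_borel_vec_mult_mat[OF A_carrier]
            measurable_borel_vec_mult_mat[OF B_carrier] w ctrl) auto
      then show ?thesis unfolding s using r by (simp add: state_Suc)
    qed
  qed
  show "t \<in> {1..Suc T} \<Longrightarrow> state L S \<pi> t \<in> measurable N (borel_vec (xdim L t))"
    by (rule state) auto
  show "t \<in> {1..T} \<Longrightarrow> observations L S \<pi> t \<in> measurable N (history_algebra L S t)"
    by (rule hist) (auto intro!: state)
  show "t \<in> {1..T} \<Longrightarrow> control L S \<pi> t \<in> measurable N (borel_vec (udim L t))"
    by (rule ctrl) (auto intro!: state)
qed

lemma closed_loop_random:
  assumes S: "S \<subseteq> sensors L" and adm: "admissible L S \<pi>"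
  shows state_measurable: "t \<in> {1..Suc T} \<Longrightarrow> state L S \<pi> t \<in> measurable P (borel_vec (xdim L t))"
    and observations_measurable: "t \<in> {1..T} \<Longrightarrow> observations L S \<pi> t \<in> measurable P (history_algebra L S t)"
    and control_measurable: "t \<in> {1..T} \<Longrightarrow> control L S \<pi> t \<in> measurable P (borel_vec (udim L t))"
  using closed_loop_measurable[OF S adm, of P t] initial_square_integrable noise_square_integrable
    measurement_noise_measurable S
  by (blast intro: square_integrable_vec_measurable)+

lemma info_subalgebra:
  assumes S: "S \<subseteq> sensors L" and adm: "admissible L S \<pi>" and t: "t \<in> {1..T}"
  shows "subalgebra P (info_algebra L S \<pi> t)"
  unfolding subalgebra_def info_algebra_def
  using sets_image_in_sets[OF refl observations_measurable[OF S adm t]] by simp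

text \<open>Perfect recall: the history at \<open>t\<close> contains every earlier history, hence
  also the controls computed from them.\<close>

lemma info_measurable:
  assumes S: "S \<subseteq> sensors L" and adm: "admissible L S \<pi>" and t: "t \<in> {1..T}" and s: "s \<in> {1..t}"
  shows "observation L S \<pi> s \<in> measurable (info_algebra L S \<pi> t) (borel_vec (\<Sum>i\<in>S. ydim L i s))"
    and "control L S \<pi> s \<in> measurable (info_algebra L S \<pi> t) (borel_vec (udim L s))"
proof -
  have obs: "observations L S \<pi> t \<in> measurable (info_algebra L S \<pi> t) (history_algebra L S t)"
    unfolding info_algebra_def using measurable_space[OF observations_measurable[OF S adm t]]
    by (intro measurable_vimage_algebra1) auto
  have out: "observation L S \<pi> r \<in> measurable (info_algebra L S \<pi> t) (borel_vec (\<Sum>i\<in>S. ydim L i r))"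
    if "r \<in> {1..t}" for r
    using measurable_compose[OF obs[unfolded history_algebra_def] measurable_component_singleton[OF that]] that
    by (simp add: observations_def)
  then show "observation L S \<pi> s \<in> measurable (info_algebra L S \<pi> t) (borel_vec (\<Sum>i\<in>S. ydim L i s))"
    using s .
  have "observations L S \<pi> s \<in> measurable (info_algebra L S \<pi> t) (history_algebra L S s)"
    unfolding observations_def history_algebra_def using s by (intro measurable_restrict out) auto
  then show "control L S \<pi> s \<in> measurable (info_algebra L S \<pi> t) (borel_vec (udim L s))"
    unfolding control_def
    by (rule measurable_compose) (use adm s t in \<open>auto simp: admissible_def\<close>)
qed

text \<open>The control enters the measurements additively and is itself a function of past
  measurements, so the measurements under one policy determine those under any other.\<close>

lemma no_dual_effect:
  assumes S: "S \<subseteq> sensors L" and adm: "admissible L S \<pi>" and adm': "admissible L S \<pi>'" and t: "t \<in> {1..T}"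
  shows "(\<lambda>\<omega>. state L S \<pi>' t \<omega> - state L S \<pi> t \<omega>) \<in> measurable (info_algebra L S \<pi> t) (borel_vec (xdim L t))"
    and "observations L S \<pi>' t \<in> measurable (info_algebra L S \<pi> t) (history_algebra L S t)"
proof -
  let ?N = "info_algebra L S \<pi> t"
  have sp: "space ?N = space P" by (simp add: info_algebra_def)
  note car = borel_vec_carrier[OF state_measurable[OF S adm]] borel_vec_carrier[OF state_measurable[OF S adm']]
    borel_vec_carrier[OF control_measurable[OF S adm]] borel_vec_carrier[OF control_measurable[OF S adm']]
  have ctrl: "control L S \<pi>' s \<in> measurable ?N (borel_vec (udim L s))"
    and hist: "observations L S \<pi>' s \<in> measurable ?N (history_algebra L S s)"
    if "s \<in> {1..t}" "\<And>r. r \<in> {1..s} \<Longrightarrow> observation L S \<pi>' r \<in> measurable ?N (borel_vec (\<Sum>i\<in>S. ydim L i r))" for s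
  proof -
    show "observations L S \<pi>' s \<in> measurable ?N (history_algebra L S s)"
      unfolding observations_def history_algebra_def using that by (intro measurable_restrict) auto
    then show "control L S \<pi>' s \<in> measurable ?N (borel_vec (udim L s))"
      unfolding control_def
      by (rule measurable_compose) (use adm' that t in \<open>auto simp: admissible_def\<close>)
  qed
  \<comment> \<open>The two claims feed each other: the state difference at \<open>s\<close> needs
    the controls of \<open>\<pi>'\<close> before \<open>s\<close>, hence its earlier observations,
    and the observation of \<open>\<pi>'\<close> at \<open>s\<close> needs the state difference at
    \<open>s\<close>.\<close>
  have main: "(\<lambda>\<omega>. state L S \<pi>' s \<omega> - state L S \<pi> s \<omega>) \<in> measurable ?N (borel_vec (xdim L s)) \<and>
      observation L S \<pi>' s \<in> measurable ?N (borel_vec (\<Sum>i\<in>S. ydim L i s))" if "s \<in> {1..t}" for s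
    using that
  proof (induction s rule: less_induct)
    case (less s)
    have d: "(\<lambda>\<omega>. state L S \<pi>' s \<omega> - state L S \<pi> s \<omega>) \<in> measurable ?N (borel_vec (xdim L s))"
    proof (cases "s = 1")
      case True
      have "(\<lambda>\<omega>. 0\<^sub>v (xdim L 1)) \<in> measurable ?N (borel_vec (xdim L 1))"
        by (rule measurable_borel_vec_const) simp
      then show ?thesis
        using True borel_vec_carrier[OF square_integrable_vec_measurable[OF initial_square_integrable]]
        by (subst measurable_cong[where g = "\<lambda>\<omega>. 0\<^sub>v (xdim L 1)"]) (auto simp: state_initial sp)
    next
      case False
      then obtain r where s: "s = Suc r" and r: "r \<in> {1..t}" "r \<in> {1..T}" "r \<in> {1..Suc T}"
        using less(2) t by (cases s) auto
      have IH: "(\<lambda>\<omega>. state L S \<pi>' r \<omega> - state L S \<pi> r \<omega>) \<in> measurable ?N (borel_vec (xdim L r))"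
        using less.IH[of r] r s by auto
      have u: "control L S \<pi>' r \<in> measurable ?N (borel_vec (udim L r))"
        using less.IH s r by (intro ctrl) auto
      \<comment> \<open>The recursion for the difference of the states: the process noise is common
        to both policies and cancels.\<close>
      have *: "(\<lambda>\<omega>. A_mat L r *\<^sub>v (state L S \<pi>' r \<omega> - state L S \<pi> r \<omega>)
          + B_mat L r *\<^sub>v (control L S \<pi>' r \<omega> - control L S \<pi> r \<omega>)) \<in> measurable ?N (borel_vec (xdim L s))"
        unfolding s using r
        by (intro measurable_borel_vec_add measurable_borel_vec_mult_mat[OF A_carrier]
            measurable_borel_vec_mult_mat[OF B_carrier] measurable_borel_vec_diff u IH info_measurable[OF S adm t])
      have "state L S \<pi>' s \<omega> - state L S \<pi> s \<omega> = A_mat L r *\<^sub>v (state L S \<pi>' r \<omega> - state L S \<pi> r \<omega>)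
          + B_mat L r *\<^sub>v (control L S \<pi>' r \<omega> - control L S \<pi> r \<omega>)" if \<omega>: "\<omega> \<in> space P" for \<omega>
      proof -
        have w: "w_noise L r \<omega> \<in> carrier_vec (xdim L (Suc r))"
          using borel_vec_carrier[OF square_integrable_vec_measurable[OF noise_square_integrable[OF r(2)]] \<omega>] .
        have alg: "(a' + b' + c) - (a + b + c) = (a' - a) + (b' - b)"
          if "a \<in> carrier_vec n" "a' \<in> carrier_vec n" "b \<in> carrier_vec n" "b' \<in> carrier_vec n" "c \<in> carrier_vec n"
          for a a' b b' c :: rvec and n
          using that by (intro eq_vecI) auto
        have "A_mat L r *\<^sub>v state L S \<pi> r \<omega> \<in> carrier_vec (xdim L (Suc r))"
          "A_mat L r *\<^sub>v state L S \<pi>' r \<omega> \<in> carrier_vec (xdim L (Suc r))"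
          "B_mat L r *\<^sub>v control L S \<pi> r \<omega> \<in> carrier_vec (xdim L (Suc r))"
          "B_mat L r *\<^sub>v control L S \<pi>' r \<omega> \<in> carrier_vec (xdim L (Suc r))"
          using A_carrier[OF r(2)] B_carrier[OF r(2)] car(1,2)[OF r(3) \<omega>] car(3,4)[OF r(2) \<omega>] by auto
        from alg[OF this w] show ?thesis
          unfolding s mult_minus_distrib_mat_vec[OF A_carrier[OF r(2)] car(2,1)[OF r(3) \<omega>]]
            mult_minus_distrib_mat_vec[OF B_carrier[OF r(2)] car(4,3)[OF r(2) \<omega>]]
          using r by (simp add: state_Suc)
      qed
      with * show ?thesis by (subst measurable_cong) (auto simp: sp)
    qed
    let ?xs = "sorted_list_of_set S"
    have st: "s \<in> {1..T}" "s \<in> {1..Suc T}" using less(2) t by auto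
    have set_xs: "set ?xs = S" using finite_subset[OF S finite_sensors] by simp
    \<comment> \<open>The shift of the stacked measurement between the two policies; the measurement
      noise cancels as well.\<close>
    let ?D = "\<lambda>\<omega>. foldr (@\<^sub>v) (map (\<lambda>i. C_mat L i s *\<^sub>v (state L S \<pi>' s \<omega> - state L S \<pi> s \<omega>)) ?xs) vNil"
    have "(\<lambda>\<omega>. observation L S \<pi> s \<omega> + ?D \<omega>) \<in> measurable ?N (borel_vec (\<Sum>i\<in>S. ydim L i s))"
    proof (rule measurable_borel_vec_add[OF info_measurable(1)[OF S adm t less(2)]])
      show "?D \<in> measurable ?N (borel_vec (\<Sum>i\<in>S. ydim L i s))"
        unfolding stack_dim[OF S, symmetric]
        using set_xs S st by (intro measurable_stack measurable_borel_vec_mult_mat[OF C_carrier] d) auto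
    qed
    moreover have "observation L S \<pi>' s \<omega> = observation L S \<pi> s \<omega> + ?D \<omega>" if \<omega>: "\<omega> \<in> space P" for \<omega>
    proof -
      have "C_mat L i s *\<^sub>v state L S \<pi>' s \<omega> + v_noise L i s \<omega>
          = (C_mat L i s *\<^sub>v state L S \<pi> s \<omega> + v_noise L i s \<omega>)
            + C_mat L i s *\<^sub>v (state L S \<pi>' s \<omega> - state L S \<pi> s \<omega>)"
        and "v_noise L i s \<omega> \<in> carrier_vec (ydim L i s)" if i: "i \<in> S" for i
      proof -
        have iS: "i \<in> sensors L" using i S by auto
        show v: "v_noise L i s \<omega> \<in> carrier_vec (ydim L i s)"
          using borel_vec_carrier[OF measurement_noise_measurable[OF st(1) iS] \<omega>] .
        have alg: "b + c = (a + c) + (b - a)"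
          if "a \<in> carrier_vec n" "b \<in> carrier_vec n" "c \<in> carrier_vec n" for a b c :: rvec and n
          using that by (intro eq_vecI) auto
        have "C_mat L i s *\<^sub>v state L S \<pi> s \<omega> \<in> carrier_vec (ydim L i s)"
          "C_mat L i s *\<^sub>v state L S \<pi>' s \<omega> \<in> carrier_vec (ydim L i s)"
          using C_carrier[OF st(1) iS] car(1,2)[OF st(2) \<omega>] by auto
        from alg[OF this v] show "C_mat L i s *\<^sub>v state L S \<pi>' s \<omega> + v_noise L i s \<omega>
          = (C_mat L i s *\<^sub>v state L S \<pi> s \<omega> + v_noise L i s \<omega>)
            + C_mat L i s *\<^sub>v (state L S \<pi>' s \<omega> - state L S \<pi> s \<omega>)"
          unfolding mult_minus_distrib_mat_vec[OF C_carrier[OF st(1) iS] car(2,1)[OF st(2) \<omega>]] .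
      qed
      note eq = this
      have "observation L S \<pi>' s \<omega> = foldr (@\<^sub>v) (map (\<lambda>i. (C_mat L i s *\<^sub>v state L S \<pi> s \<omega> + v_noise L i s \<omega>)
            + C_mat L i s *\<^sub>v (state L S \<pi>' s \<omega> - state L S \<pi> s \<omega>)) ?xs) vNil"
        unfolding observation_def stacked_output_def
        using eq(1) set_xs by (intro arg_cong2[where f = "\<lambda>xs. foldr (@\<^sub>v) xs"] map_cong refl) auto
      also have "\<dots> = observation L S \<pi> s \<omega> + ?D \<omega>"
        unfolding observation_def stacked_output_def
      proof (rule stack_add[where d = "\<lambda>i. ydim L i s"])
        fix i assume "i \<in> set ?xs"
        then have i: "i \<in> S" "i \<in> sensors L" using set_xs S by auto
        show "C_mat L i s *\<^sub>v state L S \<pi> s \<omega> + v_noise L i s \<omega> \<in> carrier_vec (ydim L i s)"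
          "C_mat L i s *\<^sub>v (state L S \<pi>' s \<omega> - state L S \<pi> s \<omega>) \<in> carrier_vec (ydim L i s)"
          using eq(2)[OF i(1)] C_carrier[OF st(1) i(2)] car(1,2)[OF st(2) \<omega>] by auto
      qed
      finally show ?thesis .
    qed
    ultimately have "observation L S \<pi>' s \<in> measurable ?N (borel_vec (\<Sum>i\<in>S. ydim L i s))"
      by (subst measurable_cong) (auto simp: sp)
    with d show ?case by blast
  qed
  show "(\<lambda>\<omega>. state L S \<pi>' t \<omega> - state L S \<pi> t \<omega>) \<in> measurable ?N (borel_vec (xdim L t))"
    "observations L S \<pi>' t \<in> measurable ?N (history_algebra L S t)"
    using main t by (auto intro!: hist)
qed

text \<open>\<open>no_dual_effect\<close> is used in both directions. A
  \<open>vimage_algebra\<close> carries the zero measure, so equality of the sets already gives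
  equality as measures, which permits rewriting inside \<open>cond_exp_vec\<close>.\<close>

lemma info_algebra_policy_independent:
  assumes S: "S \<subseteq> sensors L" and adm: "admissible L S \<pi>" and adm': "admissible L S \<pi>'" and t: "t \<in> {1..T}"
  shows "info_algebra L S \<pi> t = info_algebra L S \<pi>' t"
proof (rule measure_eqI)
  have "sets (info_algebra L S \<rho>' t) \<subseteq> sets (info_algebra L S \<rho> t)"
    if "admissible L S \<rho>" "admissible L S \<rho>'" for \<rho> \<rho>'
    unfolding info_algebra_def[of L S \<rho>']
    by (rule sets_image_in_sets) (use no_dual_effect(2)[OF S that t] in \<open>auto simp: info_algebra_def\<close>)
  then show "sets (info_algebra L S \<pi> t) = sets (info_algebra L S \<pi>' t)"
    using adm adm' by blast
qed (simp add: info_algebra_def vimage_algebra_def emeasure_sigma)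

section \<open>Second moments and orthogonality relations\<close>

lemma square_integrable_control_iff:
  assumes S: "S \<subseteq> sensors L" and adm: "admissible L S \<pi>"
  shows "square_integrable_control L S \<pi> \<longleftrightarrow>
    (\<forall>t\<in>{1..T}. square_integrable_vec P (udim L t) (control L S \<pi> t))"
proof -
  have "integrable P (\<lambda>\<omega>. control L S \<pi> t \<omega> \<bullet> control L S \<pi> t \<omega>) \<longleftrightarrow>
      square_integrable_vec P (udim L t) (control L S \<pi> t)" if t: "t \<in> {1..T}" for t
  proof -
    note u = control_measurable[OF S adm t]
    have eq: "control L S \<pi> t \<omega> \<bullet> control L S \<pi> t \<omega> = (\<Sum>i<udim L t. (vec_index (control L S \<pi> t \<omega>) i)\<^sup>2)"
      if "\<omega> \<in> space P" for \<omega>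
      using borel_vec_carrier[OF u that]
      by (auto simp: scalar_prod_def atLeast0LessThan power2_eq_square)
    have "integrable P (\<lambda>\<omega>. control L S \<pi> t \<omega> \<bullet> control L S \<pi> t \<omega>) \<longleftrightarrow>
        integrable P (\<lambda>\<omega>. \<Sum>i<udim L t. (vec_index (control L S \<pi> t \<omega>) i)\<^sup>2)"
      using eq by (rule Bochner_Integration.integrable_cong[OF refl])
    also have "\<dots> \<longleftrightarrow> (\<forall>i<udim L t. integrable P (\<lambda>\<omega>. (vec_index (control L S \<pi> t \<omega>) i)\<^sup>2))"
    proof (intro iffI allI impI)
      fix i assume int: "integrable P (\<lambda>\<omega>. \<Sum>i<udim L t. (vec_index (control L S \<pi> t \<omega>) i)\<^sup>2)" and i: "i < udim L t"
      show "integrable P (\<lambda>\<omega>. (vec_index (control L S \<pi> t \<omega>) i)\<^sup>2)"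
      proof (rule Bochner_Integration.integrable_bound[OF int])
        show "(\<lambda>\<omega>. (vec_index (control L S \<pi> t \<omega>) i)\<^sup>2) \<in> borel_measurable P"
          using borel_vec_index[OF u i] by (rule borel_measurable_power)
        show "AE \<omega> in P. norm ((vec_index (control L S \<pi> t \<omega>) i)\<^sup>2)
          \<le> norm (\<Sum>i<udim L t. (vec_index (control L S \<pi> t \<omega>) i)\<^sup>2)"
          using i by (intro AE_I2) (auto simp: sum_nonneg intro!: member_le_sum)
      qed
    qed (rule Bochner_Integration.integrable_sum, simp)
    finally show ?thesis using u unfolding square_integrable_vec_def by blast
  qed
  then show ?thesis unfolding square_integrable_control_def by blast
qed

text \<open>The drift is singled out because it is the part of the next state that is independent of
  \<open>w_t\<close>.\<close>

lemma step_square_integrable: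
  assumes t: "t \<in> {1..T}" and x: "square_integrable_vec P (xdim L t) (state L S \<pi> t)"
    and u: "square_integrable_vec P (udim L t) (control L S \<pi> t)"
  shows drift_square_integrable: "square_integrable_vec P (xdim L (Suc t))
      (\<lambda>\<omega>. A_mat L t *\<^sub>v state L S \<pi> t \<omega> + B_mat L t *\<^sub>v control L S \<pi> t \<omega>)"
    and state_square_integrable_Suc: "square_integrable_vec P (xdim L (Suc t)) (state L S \<pi> (Suc t))"
proof -
  show y: "square_integrable_vec P (xdim L (Suc t))
      (\<lambda>\<omega>. A_mat L t *\<^sub>v state L S \<pi> t \<omega> + B_mat L t *\<^sub>v control L S \<pi> t \<omega>)"
    by (intro square_integrable_vec_add square_integrable_vec_mult_mat[OF A_carrier[OF t] x]
        square_integrable_vec_mult_mat[OF B_carrier[OF t] u])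
  have "state L S \<pi> (Suc t)
      = (\<lambda>\<omega>. A_mat L t *\<^sub>v state L S \<pi> t \<omega> + B_mat L t *\<^sub>v control L S \<pi> t \<omega> + w_noise L t \<omega>)"
    using t by (auto simp: fun_eq_iff state_Suc)
  then show "square_integrable_vec P (xdim L (Suc t)) (state L S \<pi> (Suc t))"
    using square_integrable_vec_add[OF y noise_square_integrable[OF t]] by simp
qed

lemma state_initial_square_integrable: "square_integrable_vec P (xdim L (Suc 0)) (state L S \<pi> (Suc 0))"
proof -
  have "state L S \<pi> (Suc 0) = x_init L" by (simp add: fun_eq_iff state_initial)
  then show ?thesis using initial_square_integrable by simp
qed

lemma state_square_integrable:
  assumes S: "S \<subseteq> sensors L" and adm: "admissible L S \<pi>" and sq: "square_integrable_control L S \<pi>"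
  shows "t \<in> {1..Suc T} \<Longrightarrow> square_integrable_vec P (xdim L t) (state L S \<pi> t)"
\<comment> \<open>Index 0 lies outside the range, so the genuine base case is \<open>Suc 0\<close>,
  handled inside the step.\<close>
proof (induction t)
  case (Suc t)
  then show ?case
    using state_initial_square_integrable state_square_integrable_Suc[of t S \<pi>] sq
      square_integrable_control_iff[OF S adm]
    by (cases "t = 0") auto
qed simp

lemma estimate_square_integrable:
  assumes "S \<subseteq> sensors L" "admissible L S \<pi>" "t \<in> {1..T}"
    and "square_integrable_vec P (xdim L t) (state L S \<pi> t)"
  shows "square_integrable_vec P (xdim L t) (estimate L S \<pi> t)"
  unfolding estimate_eq_cond_exp_vec
  by (rule square_integrable_cond_exp_vec[OF info_subalgebra]) fact+

text \<open>Square integrability runs forward: from the state to its projection, from there to the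
  control by \<open>K_t\<close>, and on to the next state. Equality almost everywhere suffices,
  which is all that the converse half of the separation provides.\<close>

lemma certainty_equivalent_square_integrable:
  assumes S: "S \<subseteq> sensors L" and adm: "admissible L S \<pi>"
    and ce: "\<And>t. t \<in> {1..T} \<Longrightarrow> AE \<omega> in P. control L S \<pi> t \<omega> = riccati_K L t *\<^sub>v estimate L S \<pi> t \<omega>"
  shows "square_integrable_control L S \<pi>"
proof -
  have u: "square_integrable_vec P (udim L t) (control L S \<pi> t)"
    if t: "t \<in> {1..T}" and x: "square_integrable_vec P (xdim L t) (state L S \<pi> t)" for t
    using square_integrable_vec_cong_AE[OF control_measurable[OF S adm t]
        square_integrable_vec_mult_mat[OF riccati(2)[OF t t t t t] estimate_square_integrable[OF S adm t x]] ce[OF t]] .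
  have "t \<in> {1..Suc T} \<Longrightarrow> square_integrable_vec P (xdim L t) (state L S \<pi> t)" for t
  proof (induction t)
    case (Suc t)
    then show ?case
      using state_initial_square_integrable state_square_integrable_Suc[of t S \<pi>] u[of t]
      by (cases "t = 0") auto
  qed simp
  then show ?thesis
    unfolding square_integrable_control_iff[OF S adm] using u by auto
qed

text \<open>The drift is a function of sources disjoint from \<open>Process t\<close>, so the
  expectation of the product factors, and \<open>w_t\<close> has mean zero.\<close>

lemma noise_orthogonal:
  assumes S: "S \<subseteq> sensors L" and adm: "admissible L S \<pi>" and t: "t \<in> {1..T}"
    and x: "square_integrable_vec P (xdim L t) (state L S \<pi> t)"
    and u: "square_integrable_vec P (udim L t) (control L S \<pi> t)"
    and i: "i < xdim L (Suc t)" and j: "j < xdim L (Suc t)"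
  shows "(\<integral>\<omega>. vec_index (A_mat L t *\<^sub>v state L S \<pi> t \<omega> + B_mat L t *\<^sub>v control L S \<pi> t \<omega>) i
      * vec_index (w_noise L t \<omega>) j \<partial>P) = 0"
proof -
  let ?M = "\<lambda>s. borel_vec (source_dim L s)"
  \<comment> \<open>Measurement noise is included at time \<open>t\<close> itself, because
    \<open>u_t\<close> may use the measurement taken at \<open>t\<close>; process noise stops before
    \<open>t\<close>.\<close>
  let ?A = "{Initial} \<union> Process ` {1..<t} \<union> (\<lambda>(i, t). Measurement i t) ` (S \<times> {1..t})"
  let ?B = "{Process t}"
  let ?I = "{Initial} \<union> Process ` {1..T} \<union> (\<lambda>(i, t). Measurement i t) ` (sensors L \<times> {1..T})"
  let ?past = "\<lambda>\<omega>. \<lambda>s\<in>?A. source_rv L s \<omega>" and ?now = "\<lambda>\<omega>. \<lambda>s\<in>?B. source_rv L s \<omega>"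
  \<comment> \<open>The algebra of the past, to be taken as \<open>N\<close> in
    \<open>closed_loop_measurable\<close>.\<close>
  let ?N = "vimage_algebra (space P) ?past (Pi\<^sub>M ?A ?M)" and ?N' = "vimage_algebra (space P) ?now (Pi\<^sub>M ?B ?M)"
  have "indep_vars ?M (source_rv L) ?I"
    using system unfolding lqg_system_def by blast
  moreover have "?A \<inter> ?B = {}" "?A \<subseteq> ?I" "?B \<subseteq> ?I" using t S by auto
  ultimately have ind: "indep_var (Pi\<^sub>M ?A ?M) ?past (Pi\<^sub>M ?B ?M) ?now"
    by (rule indep_var_restrict)
  have past: "?past \<in> measurable ?N (Pi\<^sub>M ?A ?M)" and now: "?now \<in> measurable ?N' (Pi\<^sub>M ?B ?M)"
    using measurable_space[OF indep_var_rv1[OF ind]] measurable_space[OF indep_var_rv2[OF ind]]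
    by (intro measurable_vimage_algebra1 funcsetI; blast)+
  have src: "source_rv L s \<in> measurable ?N (?M s)" if "s \<in> ?A" for s
    using measurable_compose[OF past measurable_component_singleton[OF that]] that by simp
  have now': "w_noise L t \<in> measurable ?N' (borel_vec (xdim L (Suc t)))"
    using measurable_compose[OF now measurable_component_singleton[of "Process t"]] by simp
  have loop: "state L S \<pi> t \<in> measurable ?N (borel_vec (xdim L t))"
    "control L S \<pi> t \<in> measurable ?N (borel_vec (udim L t))"
  proof -
    have init: "x_init L \<in> measurable ?N (borel_vec (xdim L (Suc 0)))"
      using src[of Initial] by simp
    have w: "w_noise L s \<in> measurable ?N (borel_vec (xdim L (Suc s)))" if "s \<in> {1..T}" "s < t" for s
      using src[of "Process s"] that by simp
    have v: "v_noise L i s \<in> measurable ?N (borel_vec (ydim L i s))" if "i \<in> S" "s \<in> {1..T}" "s \<le> t" for i s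
    proof -
      have "Measurement i s \<in> ?A" using that by auto
      from src[OF this] show ?thesis by simp
    qed
    show "state L S \<pi> t \<in> measurable ?N (borel_vec (xdim L t))"
      "control L S \<pi> t \<in> measurable ?N (borel_vec (udim L t))"
      using closed_loop_measurable[OF S adm init w v] t by auto
  qed
  have "(\<lambda>\<omega>. A_mat L t *\<^sub>v state L S \<pi> t \<omega> + B_mat L t *\<^sub>v control L S \<pi> t \<omega>)
      \<in> measurable ?N (borel_vec (xdim L (Suc t)))"
    by (intro measurable_borel_vec_add measurable_borel_vec_mult_mat[OF A_carrier[OF t]]
        measurable_borel_vec_mult_mat[OF B_carrier[OF t]] loop)
  note f = borel_vec_index[OF this i]
  show ?thesis
    using integral_mult_indep[OF ind square_integrable_vec_index[OF drift_square_integrable[OF t x u] i] f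
        square_integrable_vec_index[OF noise_square_integrable[OF t] j] borel_vec_index[OF now' j]]
      noise_mean[OF t j] by simp
qed

text \<open>The matrix \<open>D\<close> is carried along because the estimation error enters the
  cost as \<open>K_t\<close> times the error.\<close>

lemma estimate_residual_orthogonal:
  assumes S: "S \<subseteq> sensors L" and adm: "admissible L S \<pi>" and t: "t \<in> {1..T}"
    and x: "square_integrable_vec P (xdim L t) (state L S \<pi> t)"
    and D: "D \<in> carrier_mat m (xdim L t)" and Y: "square_integrable_vec P n Y"
    and YF: "Y \<in> measurable (info_algebra L S \<pi> t) (borel_vec n)" and i: "i < n" and j: "j < m"
  shows "(\<integral>\<omega>. vec_index (Y \<omega>) i * vec_index (D *\<^sub>v (estimate L S \<pi> t \<omega> - state L S \<pi> t \<omega>)) j \<partial>P) = 0"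
proof -
  let ?e = "\<lambda>\<omega>. estimate L S \<pi> t \<omega> - state L S \<pi> t \<omega>"
  note e = square_integrable_vec_diff[OF estimate_square_integrable[OF S adm t x] x]
  have orth: "(\<integral>\<omega>. vec_index (Y \<omega>) i * vec_index (?e \<omega>) k \<partial>P) = 0" if "k < xdim L t" for k
    unfolding estimate_eq_cond_exp_vec
    by (rule cond_exp_vec_orthogonal[OF info_subalgebra[OF S adm t] x Y YF i that])
  have "(\<integral>\<omega>. vec_index (Y \<omega>) i * vec_index (D *\<^sub>v ?e \<omega>) j \<partial>P)
      = (\<integral>\<omega>. (\<Sum>k<xdim L t. D $$ (j, k) * (vec_index (Y \<omega>) i * vec_index (?e \<omega>) k)) \<partial>P)"
  proof (rule Bochner_Integration.integral_cong[OF refl])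
    fix \<omega> assume "\<omega> \<in> space P"
    then have "?e \<omega> \<in> carrier_vec (xdim L t)"
      by (rule borel_vec_carrier[OF square_integrable_vec_measurable[OF e]])
    from index_mult_mat_vec_sum[OF D this j]
    show "vec_index (Y \<omega>) i * vec_index (D *\<^sub>v ?e \<omega>) j
      = (\<Sum>k<xdim L t. D $$ (j, k) * (vec_index (Y \<omega>) i * vec_index (?e \<omega>) k))"
      by (simp only: sum_distrib_left mult.left_commute)
  qed
  also have "\<dots> = (\<Sum>k<xdim L t. (\<integral>\<omega>. D $$ (j, k) * (vec_index (Y \<omega>) i * vec_index (?e \<omega>) k) \<partial>P))"
    by (rule Bochner_Integration.integral_sum)
      (intro integrable_mult_right square_integrable_vec_prod[OF Y e i], simp)
  also have "\<dots> = 0"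
    by (intro sum.neutral ballI) (simp only: integral_mult_right_zero orth lessThan_iff mult_zero_right)
  finally show ?thesis .
qed

section \<open>Decomposition of the cost\<close>

lemma error_cov_carrier: "error_cov L S \<pi> t \<in> carrier_mat (xdim L t) (xdim L t)"
  by (simp add: error_cov_def)

text \<open>The trace identity \<open>e^T D e = tr (D e e^T)\<close>, integrated.\<close>

lemma integral_quad_form_error:
  assumes S: "S \<subseteq> sensors L" and adm: "admissible L S \<pi>" and t: "t \<in> {1..T}"
    and x: "square_integrable_vec P (xdim L t) (state L S \<pi> t)"
    and D: "D \<in> carrier_mat (xdim L t) (xdim L t)"
  shows "(\<integral>\<omega>. quad_form D (estimate L S \<pi> t \<omega> - state L S \<pi> t \<omega>) \<partial>P) = mtrace (D * error_cov L S \<pi> t)"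
proof -
  let ?n = "xdim L t"
  let ?e = "\<lambda>\<omega>. estimate L S \<pi> t \<omega> - state L S \<pi> t \<omega>"
  note hx = estimate_square_integrable[OF S adm t x]
  note e = square_integrable_vec_diff[OF hx x]
  \<comment> \<open>The indices are swapped to match the order in which \<open>mtrace_mult\<close>
    runs through the second factor.\<close>
  have cov: "error_cov L S \<pi> t $$ (j, i) = (\<integral>\<omega>. vec_index (?e \<omega>) i * vec_index (?e \<omega>) j \<partial>P)"
    if "i < ?n" "j < ?n" for i j
    unfolding error_cov_def using that carrier_vecD[OF borel_vec_carrier[OF square_integrable_vec_measurable[OF x]]]
    by (auto simp: mult.commute intro!: Bochner_Integration.integral_cong)
  show ?thesis
    unfolding mtrace_mult[OF D error_cov_carrier] quad_form_def integral_bilinear(2)[OF e e D]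
    by (intro sum.cong refl) (simp add: cov)
qed

text \<open>Written so that the \<open>N\<close> terms telescope when summed over time. The noise
  term involves neither the sensors nor the policy, the trace term only the information, and the
  last term the choice of control.\<close>

lemma stage_cost:
  assumes S: "S \<subseteq> sensors L" and adm: "admissible L S \<pi>" and sq: "square_integrable_control L S \<pi>"
    and t: "t \<in> {1..T}"
  shows "(\<integral>\<omega>. quad_form (Q_mat L t) (state L S \<pi> (Suc t) \<omega>) + quad_form (R_mat L t) (control L S \<pi> t \<omega>) \<partial>P)
    = (\<integral>\<omega>. quad_form (riccati_N L t) (state L S \<pi> t \<omega>) \<partial>P)
      - (\<integral>\<omega>. quad_form (riccati_N L (Suc t)) (state L S \<pi> (Suc t) \<omega>) \<partial>P)
      + (\<integral>\<omega>. quad_form (riccati_S L t) (w_noise L t \<omega>) \<partial>P)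
      + mtrace (riccati_Theta L t * error_cov L S \<pi> t)
      + (\<integral>\<omega>. quad_form (riccati_M L t) (control L S \<pi> t \<omega> - riccati_K L t *\<^sub>v estimate L S \<pi> t \<omega>) \<partial>P)"
proof -
  let ?x = "state L S \<pi> t" and ?x' = "state L S \<pi> (Suc t)" and ?u = "control L S \<pi> t"
    and ?h = "estimate L S \<pi> t" and ?K = "riccati_K L t" and ?M = "riccati_M L t"
    and ?N = "riccati_N L t" and ?N' = "riccati_N L (Suc t)" and ?S = "riccati_S L t"
    and ?Q = "Q_mat L t" and ?R = "R_mat L t"
  let ?y = "\<lambda>\<omega>. A_mat L t *\<^sub>v ?x \<omega> + B_mat L t *\<^sub>v ?u \<omega>"
  let ?e = "\<lambda>\<omega>. ?h \<omega> - ?x \<omega>" and ?d = "\<lambda>\<omega>. ?u \<omega> - ?K *\<^sub>v ?h \<omega>"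
  have x: "square_integrable_vec P (xdim L t) ?x" and x': "square_integrable_vec P (xdim L (Suc t)) ?x'"
    using state_square_integrable[OF S adm sq] t by auto
  have u: "square_integrable_vec P (udim L t) ?u"
    using sq square_integrable_control_iff[OF S adm] t by blast
  note y = drift_square_integrable[OF t x u]
  note h = estimate_square_integrable[OF S adm t x]
  note e = square_integrable_vec_diff[OF h x]
  have K: "?K \<in> carrier_mat (udim L t) (xdim L t)" using riccati(2) t by blast
  note d = square_integrable_vec_diff[OF u square_integrable_vec_mult_mat[OF K h]]
  note Ke = square_integrable_vec_mult_mat[OF K e]
  note car = borel_vec_carrier[OF square_integrable_vec_measurable]
  have N: "?N \<in> carrier_mat (xdim L t) (xdim L t)" and N': "?N' \<in> carrier_mat (xdim L (Suc t)) (xdim L (Suc t))"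
    using cost_to_go_semidef[of t] cost_to_go_semidef[of "Suc t"] t by (auto simp: pos_semidef_def)
  have Q: "?Q \<in> carrier_mat (xdim L (Suc t)) (xdim L (Suc t))" and R: "?R \<in> carrier_mat (udim L t) (udim L t)"
    using Q_semidef[OF t] R_pos_def[OF t] by (auto simp: pos_semidef_def pos_def_def)
  note M = M_carrier[OF t] M_symmetric[OF t]
  \<comment> \<open>Adding the cost-to-go of the next state merges \<open>Q_t\<close> and
    \<open>N\<close> at \<open>Suc t\<close> into \<open>S_t\<close>, after which the noise splits
    off.\<close>
  have "(\<integral>\<omega>. quad_form ?Q (?x' \<omega>) \<partial>P) + (\<integral>\<omega>. quad_form ?N' (?x' \<omega>) \<partial>P)
      = (\<integral>\<omega>. quad_form ?Q (?x' \<omega>) + quad_form ?N' (?x' \<omega>) \<partial>P)"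
    using integrable_quad_form[OF x' Q] integrable_quad_form[OF x' N'] by simp
  also have "\<dots> = (\<integral>\<omega>. quad_form ?S (?y \<omega> + w_noise L t \<omega>) \<partial>P)"
    using quad_form_add_mat[OF Q N' car[OF x']] t
    by (intro Bochner_Integration.integral_cong) (auto simp: riccati_S.simps[of L t] state_Suc)
  also have "\<dots> = (\<integral>\<omega>. quad_form ?S (?y \<omega>) \<partial>P) + (\<integral>\<omega>. quad_form ?S (w_noise L t \<omega>) \<partial>P)"
    by (rule integral_quad_form_add[OF y noise_square_integrable[OF t] S_carrier[OF t] S_symmetric[OF t]])
      (rule noise_orthogonal[OF S adm t x u])
  finally have 1: "(\<integral>\<omega>. quad_form ?Q (?x' \<omega>) \<partial>P) + (\<integral>\<omega>. quad_form ?N' (?x' \<omega>) \<partial>P)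
      = (\<integral>\<omega>. quad_form ?S (?y \<omega>) \<partial>P) + (\<integral>\<omega>. quad_form ?S (w_noise L t \<omega>) \<partial>P)" .
  \<comment> \<open>\<open>u - K x\<close> is a part known to the observer plus \<open>K\<close>
    times the estimation error; these two are orthogonal.\<close>
  have split: "?u \<omega> - ?K *\<^sub>v ?x \<omega> = ?d \<omega> + ?K *\<^sub>v ?e \<omega>" if \<omega>: "\<omega> \<in> space P" for \<omega>
  proof -
    have alg: "a - c = (a - b) + (b - c)"
      if "a \<in> carrier_vec n" "b \<in> carrier_vec n" "c \<in> carrier_vec n" for a b c :: rvec and n
      using that by (intro eq_vecI) auto
    have "?K *\<^sub>v ?h \<omega> \<in> carrier_vec (udim L t)" "?K *\<^sub>v ?x \<omega> \<in> carrier_vec (udim L t)"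
      using K car[OF h \<omega>] car[OF x \<omega>] by auto
    from alg[OF car[OF u \<omega>] this] show ?thesis
      unfolding mult_minus_distrib_mat_vec[OF K car[OF h \<omega>] car[OF x \<omega>]] .
  qed
  note ux = square_integrable_vec_diff[OF u square_integrable_vec_mult_mat[OF K x]]
  have "(\<integral>\<omega>. quad_form ?S (?y \<omega>) \<partial>P) + (\<integral>\<omega>. quad_form ?R (?u \<omega>) \<partial>P)
      = (\<integral>\<omega>. quad_form ?S (?y \<omega>) + quad_form ?R (?u \<omega>) \<partial>P)"
    using integrable_quad_form[OF y S_carrier[OF t]] integrable_quad_form[OF u R] by simp
  also have "\<dots> = (\<integral>\<omega>. quad_form ?N (?x \<omega>) + quad_form ?M (?u \<omega> - ?K *\<^sub>v ?x \<omega>) \<partial>P)"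
    using riccati(4)[OF t t t t t car[OF x] car[OF u]]
    by (intro Bochner_Integration.integral_cong) auto
  also have "\<dots> = (\<integral>\<omega>. quad_form ?N (?x \<omega>) \<partial>P) + (\<integral>\<omega>. quad_form ?M (?u \<omega> - ?K *\<^sub>v ?x \<omega>) \<partial>P)"
    using integrable_quad_form[OF x N] integrable_quad_form[OF ux M(1)] by simp
  also have "(\<integral>\<omega>. quad_form ?M (?u \<omega> - ?K *\<^sub>v ?x \<omega>) \<partial>P) = (\<integral>\<omega>. quad_form ?M (?d \<omega> + ?K *\<^sub>v ?e \<omega>) \<partial>P)"
    using split by (intro Bochner_Integration.integral_cong) auto
  also have "\<dots> = (\<integral>\<omega>. quad_form ?M (?d \<omega>) \<partial>P) + (\<integral>\<omega>. quad_form ?M (?K *\<^sub>v ?e \<omega>) \<partial>P)"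
  proof (rule integral_quad_form_add[OF d Ke M])
    have "?d \<in> measurable (info_algebra L S \<pi> t) (borel_vec (udim L t))"
      unfolding estimate_eq_cond_exp_vec using t
      by (intro measurable_borel_vec_diff info_measurable[OF S adm t] measurable_borel_vec_mult_mat[OF K]
          measurable_cond_exp_vec) auto
    then show "\<And>i j. i < udim L t \<Longrightarrow> j < udim L t \<Longrightarrow>
        (\<integral>\<omega>. vec_index (?d \<omega>) i * vec_index (?K *\<^sub>v ?e \<omega>) j \<partial>P) = 0"
      by (rule estimate_residual_orthogonal[OF S adm t x K d])
  qed
  \<comment> \<open>The origin of \<open>Theta_t = K_t^T M_t K_t\<close>: the price, in the norm of
    \<open>M_t\<close>, of acting on the estimate in place of the state.\<close>
  also have "(\<integral>\<omega>. quad_form ?M (?K *\<^sub>v ?e \<omega>) \<partial>P) = (\<integral>\<omega>. quad_form (riccati_Theta L t) (?e \<omega>) \<partial>P)"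
    unfolding riccati_Theta_def using quad_form_congruence[OF M(1) K car[OF e]]
    by (intro Bochner_Integration.integral_cong) auto
  also have "\<dots> = mtrace (riccati_Theta L t * error_cov L S \<pi> t)"
    using K M(1) by (intro integral_quad_form_error[OF S adm t x]) (auto simp: riccati_Theta_def)
  finally have 2: "(\<integral>\<omega>. quad_form ?S (?y \<omega>) \<partial>P) + (\<integral>\<omega>. quad_form ?R (?u \<omega>) \<partial>P)
      = (\<integral>\<omega>. quad_form ?N (?x \<omega>) \<partial>P) + ((\<integral>\<omega>. quad_form ?M (?d \<omega>) \<partial>P)
        + mtrace (riccati_Theta L t * error_cov L S \<pi> t))" .
  have "(\<integral>\<omega>. quad_form ?Q (?x' \<omega>) + quad_form ?R (?u \<omega>) \<partial>P)
      = (\<integral>\<omega>. quad_form ?Q (?x' \<omega>) \<partial>P) + (\<integral>\<omega>. quad_form ?R (?u \<omega>) \<partial>P)"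
    using integrable_quad_form[OF x' Q] integrable_quad_form[OF u R] by simp
  with 1 2 show ?thesis by simp
qed

definition noise_cost :: real where
  "noise_cost = (\<integral>\<omega>. quad_form (riccati_N L (Suc 0)) (x_init L \<omega>) \<partial>P)
     + (\<Sum>t = 1..T. \<integral>\<omega>. quad_form (riccati_S L t) (w_noise L t \<omega>) \<partial>P)"

text \<open>The reference control uses the estimate along the trajectory steered by
  \<open>\<pi>\<close> itself, not along an optimal one; so vanishing regret is a condition on
  \<open>\<pi>\<close> alone.\<close>

definition control_regret :: "'i set \<Rightarrow> policy \<Rightarrow> real" where
  "control_regret S \<pi> = (\<Sum>t = 1..T. \<integral>\<omega>. quad_form (riccati_M L t)
     (control L S \<pi> t \<omega> - riccati_K L t *\<^sub>v estimate L S \<pi> t \<omega>) \<partial>P)"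

lemma stage_nonneg:
  assumes S: "S \<subseteq> sensors L" and adm: "admissible L S \<pi>" and t: "t \<in> {1..T}" and \<omega>: "\<omega> \<in> space P"
  shows "0 \<le> quad_form (Q_mat L t) (state L S \<pi> (Suc t) \<omega>)" "0 \<le> quad_form (R_mat L t) (control L S \<pi> t \<omega>)"
  using Q_semidef[OF t] pos_def_imp_semidef[OF R_pos_def[OF t]] borel_vec_carrier[OF control_measurable[OF S adm t] \<omega>]
    borel_vec_carrier[OF state_measurable[OF S adm, of "Suc t"] \<omega>] t
  by (auto simp: pos_semidef_def)

text \<open>\<open>ennreal\<close> truncates negative numbers to 0, so the second claim is what
  allows inequalities between costs to be pulled back to the reals.\<close>

lemma cost_decomposition:
  assumes S: "S \<subseteq> sensors L" and adm: "admissible L S \<pi>" and sq: "square_integrable_control L S \<pi>"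
  shows "lqg_cost L S \<pi> = ennreal (noise_cost + sensing_cost L S \<pi> + control_regret S \<pi>)"
    and "0 \<le> noise_cost + sensing_cost L S \<pi> + control_regret S \<pi>"
proof -
  let ?g = "\<lambda>t \<omega>. quad_form (Q_mat L t) (state L S \<pi> (Suc t) \<omega>) + quad_form (R_mat L t) (control L S \<pi> t \<omega>)"
  let ?n = "\<lambda>t. \<integral>\<omega>. quad_form (riccati_N L t) (state L S \<pi> t \<omega>) \<partial>P"
  have nonneg: "0 \<le> ?g t \<omega>" if "t \<in> {1..T}" "\<omega> \<in> space P" for t \<omega>
    using stage_nonneg[OF S adm that] by simp
  have int: "integrable P (?g t)" if t: "t \<in> {1..T}" for t
    using integrable_quad_form[of P "xdim L (Suc t)" "state L S \<pi> (Suc t)" "Q_mat L t"]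
      integrable_quad_form[of P "udim L t" "control L S \<pi> t" "R_mat L t"]
      state_square_integrable[OF S adm sq, of "Suc t"] sq square_integrable_control_iff[OF S adm] t
      Q_semidef[OF t] R_pos_def[OF t]
    by (auto simp: pos_semidef_def pos_def_def)
  have nn: "0 \<le> (\<integral>\<omega>. ?g t \<omega> \<partial>P)" if "t \<in> {1..T}" for t
    using nonneg[OF that] by (intro integral_nonneg_AE AE_I2)
  have "lqg_cost L S \<pi> = (\<Sum>t = 1..T. ennreal (\<integral>\<omega>. ?g t \<omega> \<partial>P))"
    unfolding lqg_cost_def using nonneg
    by (intro sum.cong refl) (auto intro!: nn_integral_eq_integral int)
  also have "\<dots> = ennreal (\<Sum>t = 1..T. \<integral>\<omega>. ?g t \<omega> \<partial>P)"
    using nn by (intro sum_ennreal)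
  finally have cost: "lqg_cost L S \<pi> = ennreal (\<Sum>t = 1..T. \<integral>\<omega>. ?g t \<omega> \<partial>P)" .
  \<comment> \<open>The boundary condition on \<open>N\<close> removes the upper end of the
    telescoping sum and leaves the initial term, which depends on \<open>x_1\<close> alone.\<close>
  have terminal: "?n (Suc T) = 0"
  proof -
    have "(\<integral>\<omega>. quad_form (riccati_N L (Suc T)) (state L S \<pi> (Suc T) \<omega>) \<partial>P) = (\<integral>\<omega>. 0 \<partial>P)"
      unfolding riccati_N_terminal using borel_vec_carrier[OF state_measurable[OF S adm, of "Suc T"]]
      by (intro Bochner_Integration.integral_cong) (auto simp: quad_form_eq_sum[of _ "xdim L (Suc T)"])
    then show ?thesis by simp
  qed
  have "(\<Sum>t = 1..T. \<integral>\<omega>. ?g t \<omega> \<partial>P) = (\<Sum>t = 1..T. ?n t - ?n (Suc t))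
      + (\<Sum>t = 1..T. \<integral>\<omega>. quad_form (riccati_S L t) (w_noise L t \<omega>) \<partial>P)
      + sensing_cost L S \<pi> + control_regret S \<pi>"
    unfolding sensing_cost_def control_regret_def sum.distrib[symmetric]
    by (intro sum.cong refl stage_cost[OF S adm sq])
  also have "(\<Sum>t = 1..T. ?n t - ?n (Suc t)) = - (\<Sum>t = 1..T. ?n (Suc t) - ?n t)"
    unfolding sum_negf[symmetric] by (intro sum.cong refl) simp
  also have "\<dots> = ?n (Suc 0)"
    using sum_Suc_diff[of 1 T ?n] terminal by simp
  finally have eq: "(\<Sum>t = 1..T. \<integral>\<omega>. ?g t \<omega> \<partial>P)
      = noise_cost + sensing_cost L S \<pi> + control_regret S \<pi>"
    unfolding noise_cost_def by (simp add: state_initial)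
  show "lqg_cost L S \<pi> = ennreal (noise_cost + sensing_cost L S \<pi> + control_regret S \<pi>)"
    unfolding cost eq ..
  show "0 \<le> noise_cost + sensing_cost L S \<pi> + control_regret S \<pi>"
    unfolding eq[symmetric] using nn by (rule sum_nonneg)
qed

text \<open>Both parts of a stage are nonnegative, so the control part alone has finite expectation;
  \<open>pos_def_coordinate_bound\<close> for \<open>R_t\<close> then bounds each squared coordinate
  of the control.\<close>

lemma finite_cost_square_integrable:
  assumes S: "S \<subseteq> sensors L" and adm: "admissible L S \<pi>" and fin: "lqg_cost L S \<pi> < \<infinity>"
  shows "square_integrable_control L S \<pi>"
  unfolding square_integrable_control_iff[OF S adm]
proof
  fix t assume t: "t \<in> {1..T}"
  let ?R = "R_mat L t" and ?u = "control L S \<pi> t"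
  note u = control_measurable[OF S adm t]
  have R: "?R \<in> carrier_mat (udim L t) (udim L t)" "invertible_mat ?R"
    using R_pos_def[OF t] invertible t by (auto simp: pos_def_def riccati_invertible_def)
  have "(\<integral>\<^sup>+\<omega>. ennreal (quad_form ?R (?u \<omega>)) \<partial>P)
      \<le> (\<integral>\<^sup>+\<omega>. ennreal (quad_form (Q_mat L t) (state L S \<pi> (t + 1) \<omega>) + quad_form ?R (?u \<omega>)) \<partial>P)"
    using stage_nonneg[OF S adm t] by (intro nn_integral_mono ennreal_leI) simp
  also have "\<dots> \<le> lqg_cost L S \<pi>"
    unfolding lqg_cost_def using t by (intro member_le_sum) auto
  also note fin
  finally have int: "integrable P (\<lambda>\<omega>. quad_form ?R (?u \<omega>))"
    using stage_nonneg(2)[OF S adm t] by (intro integrableI_nonneg measurable_quad_form[OF R(1) u] AE_I2) auto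
  show "square_integrable_vec P (udim L t) ?u"
    unfolding square_integrable_vec_def
  proof (intro conjI allI impI u)
    fix i assume i: "i < udim L t"
    obtain c where c: "\<And>x. x \<in> carrier_vec (udim L t) \<Longrightarrow> (vec_index x i)\<^sup>2 \<le> c * quad_form ?R x"
      using pos_def_coordinate_bound[OF R_pos_def[OF t] R(2) i] by blast
    show "integrable P (\<lambda>\<omega>. (vec_index (?u \<omega>) i)\<^sup>2)"
    proof (rule Bochner_Integration.integrable_bound)
      show "integrable P (\<lambda>\<omega>. c * quad_form ?R (?u \<omega>))" using int by simp
      show "(\<lambda>\<omega>. (vec_index (?u \<omega>) i)\<^sup>2) \<in> borel_measurable P"
        using borel_vec_index[OF u i] by (rule borel_measurable_power)
      show "AE \<omega> in P. norm ((vec_index (?u \<omega>) i)\<^sup>2) \<le> norm (c * quad_form ?R (?u \<omega>))"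
        using c[OF borel_vec_carrier[OF u]] by (intro AE_I2) fastforce
    qed
  qed
qed

text \<open>Changing the policy adds to the state a vector known to the observer; the estimate moves
  by the same vector and the error stays put.\<close>

lemma estimation_error_policy_independent:
  assumes S: "S \<subseteq> sensors L" and adm: "admissible L S \<pi>" and adm': "admissible L S \<pi>'"
    and sq: "square_integrable_control L S \<pi>" and sq': "square_integrable_control L S \<pi>'" and t: "t \<in> {1..T}"
  shows "AE \<omega> in P. estimate L S \<pi>' t \<omega> - state L S \<pi>' t \<omega> = estimate L S \<pi> t \<omega> - state L S \<pi> t \<omega>"
proof -
  let ?F = "info_algebra L S \<pi> t" and ?d = "\<lambda>\<omega>. state L S \<pi>' t \<omega> - state L S \<pi> t \<omega>"
  note F = info_subalgebra[OF S adm t]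
  have x: "square_integrable_vec P (xdim L t) (state L S \<pi> t)" and x': "square_integrable_vec P (xdim L t) (state L S \<pi>' t)"
    using state_square_integrable[OF S adm sq] state_square_integrable[OF S adm' sq'] t by auto
  note d = square_integrable_vec_diff[OF x' x]
  note car = borel_vec_carrier[OF square_integrable_vec_measurable]
  have alg: "b = a + (b - a)" "(c + (b - a)) - b = c - a"
    if "a \<in> carrier_vec n" "b \<in> carrier_vec n" "c \<in> carrier_vec n" for a b c :: rvec and n
    using that by (auto intro!: eq_vecI)
  have "AE \<omega> in P. cond_exp_vec P ?F (xdim L t) (state L S \<pi>' t) \<omega>
      = cond_exp_vec P ?F (xdim L t) (\<lambda>\<omega>. state L S \<pi> t \<omega> + ?d \<omega>) \<omega>"
    using alg(1)[OF car[OF x] car[OF x'] car[OF x]] square_integrable_vec_measurable[OF x']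
      square_integrable_vec_measurable[OF square_integrable_vec_add[OF x d]]
    by (intro cond_exp_vec_cong[OF F]) auto
  moreover note cond_exp_vec_add_measurable[OF F x d no_dual_effect(1)[OF S adm adm' t]]
  ultimately show ?thesis
    using AE_space
  proof eventually_elim
    case (elim \<omega>)
    \<comment> \<open>Both estimates are first brought to the same conditioning algebra.\<close>
    have "estimate L S \<pi>' t \<omega> = estimate L S \<pi> t \<omega> + ?d \<omega>"
      unfolding estimate_eq_cond_exp_vec info_algebra_policy_independent[OF S adm' adm t] using elim by simp
    then show ?case
      using alg(2)[OF car[OF x elim(3)] car[OF x' elim(3)] car[OF estimate_square_integrable[OF S adm t x] elim(3)]]
      by simp
  qed
qed

lemma error_cov_policy_independent:
  assumes S: "S \<subseteq> sensors L" and adm: "admissible L S \<pi>" and adm': "admissible L S \<pi>'"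
    and sq: "square_integrable_control L S \<pi>" and sq': "square_integrable_control L S \<pi>'" and t: "t \<in> {1..T}"
  shows "error_cov L S \<pi> t = error_cov L S \<pi>' t"
proof (rule eq_matI)
  fix i j assume "i < dim_row (error_cov L S \<pi>' t)" "j < dim_col (error_cov L S \<pi>' t)"
  then have ij: "i < xdim L t" "j < xdim L t" by (auto simp: error_cov_def)
  have x: "state L S \<rho> t \<in> measurable P (borel_vec (xdim L t))" if "admissible L S \<rho>" for \<rho>
    using state_measurable[OF S that] t by auto
  have h: "estimate L S \<rho> t \<in> measurable P (borel_vec (xdim L t))" for \<rho>
    unfolding estimate_eq_cond_exp_vec by (rule measurable_cond_exp_vec2)
  have m: "(\<lambda>\<omega>. (vec_index (estimate L S \<rho> t \<omega>) i - vec_index (state L S \<rho> t \<omega>) i)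
      * (vec_index (estimate L S \<rho> t \<omega>) j - vec_index (state L S \<rho> t \<omega>) j)) \<in> borel_measurable P"
    if "admissible L S \<rho>" for \<rho>
    by (intro borel_measurable_times borel_measurable_diff borel_vec_index[OF h] borel_vec_index[OF x[OF that]] ij)
  have "(\<integral>\<omega>. (vec_index (estimate L S \<pi> t \<omega>) i - vec_index (state L S \<pi> t \<omega>) i)
        * (vec_index (estimate L S \<pi> t \<omega>) j - vec_index (state L S \<pi> t \<omega>) j) \<partial>P)
      = (\<integral>\<omega>. (vec_index (estimate L S \<pi>' t \<omega>) i - vec_index (state L S \<pi>' t \<omega>) i)
        * (vec_index (estimate L S \<pi>' t \<omega>) j - vec_index (state L S \<pi>' t \<omega>) j) \<partial>P)"
  proof (rule integral_cong_AE[OF m[OF adm] m[OF adm']])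
    have idx: "vec_index a k - vec_index b k = vec_index (a - b) k" if "b \<in> carrier_vec n" "k < n"
      for a b :: rvec and k n using that by simp
    show "AE \<omega> in P. (vec_index (estimate L S \<pi> t \<omega>) i - vec_index (state L S \<pi> t \<omega>) i)
        * (vec_index (estimate L S \<pi> t \<omega>) j - vec_index (state L S \<pi> t \<omega>) j)
      = (vec_index (estimate L S \<pi>' t \<omega>) i - vec_index (state L S \<pi>' t \<omega>) i)
        * (vec_index (estimate L S \<pi>' t \<omega>) j - vec_index (state L S \<pi>' t \<omega>) j)"
      using estimation_error_policy_independent[OF S adm adm' sq sq' t] AE_space
    proof eventually_elim
      case (elim \<omega>)
      show ?case
        unfolding idx[OF borel_vec_carrier[OF x[OF adm] elim(2)] ij(1)] idx[OF borel_vec_carrier[OF x[OF adm] elim(2)] ij(2)]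
          idx[OF borel_vec_carrier[OF x[OF adm'] elim(2)] ij(1)] idx[OF borel_vec_carrier[OF x[OF adm'] elim(2)] ij(2)]
          elim(1) ..
    qed
  qed
  then show "error_cov L S \<pi> t $$ (i, j) = error_cov L S \<pi>' t $$ (i, j)"
    using ij by (simp add: error_cov_def)
qed (simp_all add: error_cov_def)

lemma sensing_cost_policy_independent:
  assumes "S \<subseteq> sensors L" "admissible L S \<pi>" "admissible L S \<pi>'"
    and "square_integrable_control L S \<pi>" "square_integrable_control L S \<pi>'"
  shows "sensing_cost L S \<pi> = sensing_cost L S \<pi>'"
  unfolding sensing_cost_def
  by (intro sum.cong refl) (simp only: error_cov_policy_independent[OF assms])

section \<open>Policies without regret, and the separation\<close>

lemma zero_policy_admissible: "admissible L S (\<lambda>t h. 0\<^sub>v (udim L t))"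
  unfolding admissible_def by (intro ballI measurable_borel_vec_const) simp

text \<open>The estimate at time \<open>t\<close> depends only on the policy before \<open>t\<close>, so the certainty equivalent
  policy can be built forward in time, factoring each control through the observations.\<close>

lemma certainty_equivalent_policy_upto:
  assumes S: "S \<subseteq> sensors L"
  shows "n \<le> T \<Longrightarrow> \<exists>\<pi>. admissible L S \<pi> \<and>
    (\<forall>t\<in>{1..n}. \<forall>\<omega>\<in>space P. control L S \<pi> t \<omega> = riccati_K L t *\<^sub>v estimate L S \<pi> t \<omega>)"
proof (induction n)
  case 0
  then show ?case using zero_policy_admissible by auto
next
  case (Suc n)
  define t where "t = Suc n"
  have t: "t \<in> {1..T}" using Suc(2) by (simp add: t_def)
  from Suc obtain \<pi> where adm: "admissible L S \<pi>"
    and ce: "\<And>s \<omega>. s \<in> {1..n} \<Longrightarrow> \<omega> \<in> space P \<Longrightarrow> control L S \<pi> s \<omega> = riccati_K L s *\<^sub>v estimate L S \<pi> s \<omega>"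
    by auto
  have K: "riccati_K L t \<in> carrier_mat (udim L t) (xdim L t)" using riccati(2) t by blast
  let ?f = "\<lambda>\<omega>. riccati_K L t *\<^sub>v estimate L S \<pi> t \<omega>"
  have f: "?f \<in> measurable (info_algebra L S \<pi> t) (borel_vec (udim L t))"
    unfolding estimate_eq_cond_exp_vec
    by (rule measurable_borel_vec_mult_mat[OF K measurable_cond_exp_vec])
  have obs: "observations L S \<pi> t \<in> space P \<rightarrow> space (history_algebra L S t)"
    using measurable_space[OF observations_measurable[OF S adm t]] by auto
  have "\<exists>g\<in>borel_measurable (history_algebra L S t). \<forall>\<omega>\<in>space P. vec_index (?f \<omega>) i = g (observations L S \<pi> t \<omega>)"
    if "i < udim L t" for i
    using Doob_Dynkin_real[OF obs borel_vec_index[OF f that, unfolded info_algebra_def]] by metis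
  then obtain g where g: "\<And>i. i < udim L t \<Longrightarrow> g i \<in> borel_measurable (history_algebra L S t)"
    "\<And>i \<omega>. i < udim L t \<Longrightarrow> \<omega> \<in> space P \<Longrightarrow> vec_index (?f \<omega>) i = g i (observations L S \<pi> t \<omega>)"
    by metis
  define \<phi> where "\<phi> h = Matrix.vec (udim L t) (\<lambda>i. g i h)" for h
  \<comment> \<open>Only time \<open>t\<close> is overridden. By causality the observations and
    estimates up to \<open>t\<close> are unchanged, so the equations at earlier times persist, and
    the one at \<open>t\<close> may be stated with the estimate of the old policy.\<close>
  define \<pi>' where "\<pi>' = \<pi>(t := \<phi>)"
  have "\<phi> \<in> measurable (history_algebra L S t) (borel_vec (udim L t))"
    by (rule measurable_borel_vecI) (simp_all add: \<phi>_def g)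
  then have "admissible L S \<pi>'" using adm by (simp add: admissible_def \<pi>'_def)
  moreover have "control L S \<pi>' s \<omega> = riccati_K L s *\<^sub>v estimate L S \<pi>' s \<omega>"
    if s: "s \<in> {1..t}" and \<omega>: "\<omega> \<in> space P" for s \<omega>
  proof -
    have "\<pi> r = \<pi>' r" if "r < s" for r using that s by (simp add: \<pi>'_def)
    then have eq: "observations L S \<pi> s = observations L S \<pi>' s" "estimate L S \<pi> s = estimate L S \<pi>' s"
      by (simp_all add: observations_cong[of s \<pi> \<pi>'] estimate_cong[of s \<pi> \<pi>'])
    show ?thesis
    proof (cases "s = t")
      case True
      have "\<phi> (observations L S \<pi> t \<omega>) = ?f \<omega>"
        using g(2) \<omega> K by (intro eq_vecI) (simp_all add: \<phi>_def del: index_mult_mat_vec)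
      then show ?thesis using eq by (simp add: True control_def \<pi>'_def)
    next
      case False
      then have "control L S \<pi>' s \<omega> = control L S \<pi> s \<omega>" unfolding control_def eq by (simp add: \<pi>'_def)
      then show ?thesis using ce[of s \<omega>] False s \<omega> by (simp add: t_def eq)
    qed
  qed
  ultimately show ?case unfolding t_def by blast
qed

lemma certainty_equivalent_policy:
  assumes S: "S \<subseteq> sensors L"
  obtains \<pi> where "admissible L S \<pi>" "square_integrable_control L S \<pi>" "control_regret S \<pi> = 0"
proof -
  obtain \<pi> where adm: "admissible L S \<pi>"
    and ce: "\<And>t \<omega>. t \<in> {1..T} \<Longrightarrow> \<omega> \<in> space P \<Longrightarrow> control L S \<pi> t \<omega> = riccati_K L t *\<^sub>v estimate L S \<pi> t \<omega>"
    using certainty_equivalent_policy_upto[OF S, of T] by blast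
  have sq: "square_integrable_control L S \<pi>"
    by (rule certainty_equivalent_square_integrable[OF S adm]) (rule AE_I2, rule ce)
  show ?thesis
  proof (rule that[OF adm sq])
    have "(\<integral>\<omega>. quad_form (riccati_M L t) (control L S \<pi> t \<omega> - riccati_K L t *\<^sub>v estimate L S \<pi> t \<omega>) \<partial>P) = (\<integral>\<omega>. 0 \<partial>P)"
      if t: "t \<in> {1..T}" for t
    proof (rule Bochner_Integration.integral_cong[OF refl])
      fix \<omega> assume \<omega>: "\<omega> \<in> space P"
      have "control L S \<pi> t \<omega> - riccati_K L t *\<^sub>v estimate L S \<pi> t \<omega> = 0\<^sub>v (udim L t)"
        using borel_vec_carrier[OF control_measurable[OF S adm t] \<omega>] unfolding ce[OF t \<omega>, symmetric] by simp
      then show "quad_form (riccati_M L t) (control L S \<pi> t \<omega> - riccati_K L t *\<^sub>v estimate L S \<pi> t \<omega>) = 0"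
        using M_carrier[OF t] by (simp add: quad_form_eq_sum[of _ "udim L t"])
    qed
    then show "control_regret S \<pi> = 0" unfolding control_regret_def by simp
  qed
qed

text \<open>\<open>M_t\<close> is positive definite: a nonnegative integrand with zero integral
  vanishes almost everywhere, and definiteness then forces the two controls to agree.\<close>

lemma control_regret_properties:
  assumes S: "S \<subseteq> sensors L" and adm: "admissible L S \<pi>" and sq: "square_integrable_control L S \<pi>"
  shows control_regret_nonneg: "0 \<le> control_regret S \<pi>"
    and control_regret_eq_0_iff: "control_regret S \<pi> = 0 \<longleftrightarrow>
      (\<forall>t\<in>{1..T}. AE \<omega> in P. control L S \<pi> t \<omega> = riccati_K L t *\<^sub>v estimate L S \<pi> t \<omega>)"
proof -
  let ?d = "\<lambda>t \<omega>. control L S \<pi> t \<omega> - riccati_K L t *\<^sub>v estimate L S \<pi> t \<omega>"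
  let ?q = "\<lambda>t \<omega>. quad_form (riccati_M L t) (?d t \<omega>)"
  have K: "riccati_K L t \<in> carrier_mat (udim L t) (xdim L t)" if "t \<in> {1..T}" for t
    using riccati(2) that by blast
  have d: "square_integrable_vec P (udim L t) (?d t)" if t: "t \<in> {1..T}" for t
    using sq square_integrable_control_iff[OF S adm] t state_square_integrable[OF S adm sq, of t]
    by (intro square_integrable_vec_diff square_integrable_vec_mult_mat[OF K[OF t]]
        estimate_square_integrable[OF S adm t]) auto
  note car = borel_vec_carrier[OF square_integrable_vec_measurable[OF d]]
  have nonneg: "0 \<le> ?q t \<omega>" if "t \<in> {1..T}" "\<omega> \<in> space P" for t \<omega>
    using pos_def_imp_semidef[OF riccati(1)] car[OF that] that by (auto simp: pos_semidef_def)
  have nn: "0 \<le> (\<integral>\<omega>. ?q t \<omega> \<partial>P)" if "t \<in> {1..T}" for t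
    using nonneg[OF that] by (intro integral_nonneg_AE AE_I2)
  then show "0 \<le> control_regret S \<pi>" unfolding control_regret_def by (rule sum_nonneg)
  have zero: "?q t \<omega> = 0 \<longleftrightarrow> control L S \<pi> t \<omega> = riccati_K L t *\<^sub>v estimate L S \<pi> t \<omega>"
    if t: "t \<in> {1..T}" and \<omega>: "\<omega> \<in> space P" for t \<omega>
  proof -
    have "?q t \<omega> = 0 \<longleftrightarrow> ?d t \<omega> = 0\<^sub>v (udim L t)"
    proof
      assume "?q t \<omega> = 0"
      then show "?d t \<omega> = 0\<^sub>v (udim L t)"
        using riccati(1)[OF t t t t t] car[OF t \<omega>] unfolding pos_def_def by force
    next
      assume "?d t \<omega> = 0\<^sub>v (udim L t)"
      then show "?q t \<omega> = 0" using M_carrier[OF t] by (simp add: quad_form_eq_sum[of _ "udim L t"])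
    qed
    also have "\<dots> \<longleftrightarrow> control L S \<pi> t \<omega> = riccati_K L t *\<^sub>v estimate L S \<pi> t \<omega>"
    proof -
      have "a - b = 0\<^sub>v n \<longleftrightarrow> a = b" if "a \<in> carrier_vec n" "b \<in> carrier_vec n" for a b :: rvec and n
        using that by (auto simp: vec_eq_iff)
      moreover have "riccati_K L t *\<^sub>v estimate L S \<pi> t \<omega> \<in> carrier_vec (udim L t)"
        using K[OF t] by (simp add: estimate_def)
      ultimately show ?thesis
        using borel_vec_carrier[OF control_measurable[OF S adm t] \<omega>] by blast
    qed
    finally show ?thesis .
  qed
  have "control_regret S \<pi> = 0 \<longleftrightarrow> (\<forall>t\<in>{1..T}. (\<integral>\<omega>. ?q t \<omega> \<partial>P) = 0)"
    unfolding control_regret_def using nn by (intro sum_nonneg_eq_0_iff) auto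
  also have "\<dots> \<longleftrightarrow> (\<forall>t\<in>{1..T}. AE \<omega> in P. ?q t \<omega> = 0)"
    using integrable_quad_form[OF d M_carrier] nonneg
    by (intro ball_cong refl integral_nonneg_eq_0_iff_AE AE_I2) auto
  also have "\<dots> \<longleftrightarrow> (\<forall>t\<in>{1..T}. AE \<omega> in P. control L S \<pi> t \<omega> = riccati_K L t *\<^sub>v estimate L S \<pi> t \<omega>)"
    using zero by (intro ball_cong refl AE_cong)
  finally show "control_regret S \<pi> = 0 \<longleftrightarrow>
      (\<forall>t\<in>{1..T}. AE \<omega> in P. control L S \<pi> t \<omega> = riccati_K L t *\<^sub>v estimate L S \<pi> t \<omega>)" .
qed

lemma separation:
  "lqg_solution L k S \<pi> \<longleftrightarrow> sensing_optimal L k S \<and> admissible L S \<pi> \<and>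
    (\<forall>t\<in>{1..T}. AE \<omega> in P. control L S \<pi> t \<omega> = riccati_K L t *\<^sub>v estimate L S \<pi> t \<omega>)"
    (is "?sol \<longleftrightarrow> _ \<and> _ \<and> ?ce")
proof
  assume ?sol
  then have S: "S \<subseteq> sensors L" "card S \<le> k" and adm: "admissible L S \<pi>"
    and opt: "\<And>S' u. S' \<subseteq> sensors L \<Longrightarrow> card S' \<le> k \<Longrightarrow> admissible L S' u \<Longrightarrow> lqg_cost L S \<pi> \<le> lqg_cost L S' u"
    unfolding lqg_solution_def is_arg_min_def by (auto simp: not_less)
  \<comment> \<open>A competitor of finite cost, whose sole purpose is to make the optimal cost
    finite and hence \<open>\<pi>\<close> square integrable.\<close>
  obtain \<rho> where \<rho>: "admissible L S \<rho>" "square_integrable_control L S \<rho>" "control_regret S \<rho> = 0"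
    using certainty_equivalent_policy[OF S(1)] .
  have "lqg_cost L S \<pi> \<le> lqg_cost L S \<rho>" by (rule opt[OF S \<rho>(1)])
  also have "\<dots> < \<infinity>" by (simp add: cost_decomposition(1)[OF S(1) \<rho>(1,2)])
  finally have sq: "square_integrable_control L S \<pi>"
    by (rule finite_cost_square_integrable[OF S(1) adm])
  \<comment> \<open>The competitor \<open>u\<close> is replaced by a regret-free
    \<open>\<sigma>\<close> on the same sensors, which has the same sensing cost;
    \<open>noise_cost\<close> cancels.\<close>
  have compare: "sensing_cost L S \<pi> + control_regret S \<pi> \<le> sensing_cost L S' u"
    if S': "S' \<subseteq> sensors L" "card S' \<le> k" and u: "admissible L S' u" "square_integrable_control L S' u" for S' u
  proof -
    obtain \<sigma> where \<sigma>: "admissible L S' \<sigma>" "square_integrable_control L S' \<sigma>" "control_regret S' \<sigma> = 0"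
      using certainty_equivalent_policy[OF S'(1)] .
    have "lqg_cost L S \<pi> \<le> lqg_cost L S' \<sigma>" by (rule opt[OF S' \<sigma>(1)])
    then show ?thesis
      using cost_decomposition[OF S(1) adm sq] cost_decomposition[OF S'(1) \<sigma>(1,2)] \<sigma>(3)
        sensing_cost_policy_independent[OF S'(1) u(1) \<sigma>(1) u(2) \<sigma>(2)]
      by (simp add: ennreal_le_iff)
  qed
  \<comment> \<open>Comparing \<open>\<pi>\<close> with itself already yields
    \<open>sensing + regret \<le> sensing\<close>.\<close>
  have "control_regret S \<pi> = 0"
    using compare[OF S adm sq] control_regret_nonneg[OF S(1) adm sq] by simp
  then have ?ce by (simp add: control_regret_eq_0_iff[OF S(1) adm sq])
  moreover have "sensing_optimal L k S"
    unfolding sensing_optimal_def is_arg_min_def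
  proof (intro allI impI conjI S notI)
    fix u assume u: "\<forall>S'. S' \<subseteq> sensors L \<and> card S' \<le> k \<longrightarrow> admissible L S' (u S') \<and> square_integrable_control L S' (u S')"
    assume "\<exists>S'. (S' \<subseteq> sensors L \<and> card S' \<le> k) \<and> sensing_cost L S' (u S') < sensing_cost L S (u S)"
    then obtain S' where S': "S' \<subseteq> sensors L" "card S' \<le> k" "sensing_cost L S' (u S') < sensing_cost L S (u S)" by blast
    have "sensing_cost L S (u S) = sensing_cost L S \<pi>"
      using u S by (intro sensing_cost_policy_independent[OF S(1)] adm sq) auto
    then show False
      using compare[OF S'(1,2), of "u S'"] u S' control_regret_nonneg[OF S(1) adm sq] by simp
  qed
  ultimately show "sensing_optimal L k S \<and> admissible L S \<pi> \<and> ?ce" using adm by blast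
next
  assume asm: "sensing_optimal L k S \<and> admissible L S \<pi> \<and> ?ce"
  then have adm: "admissible L S \<pi>" by blast
  \<comment> \<open>\<open>sensing_optimal\<close> is an implication over families of control laws;
    to extract anything from it, one such family must be exhibited.\<close>
  have ex: "\<exists>\<rho>. S' \<subseteq> sensors L \<longrightarrow> admissible L S' \<rho> \<and> square_integrable_control L S' \<rho>" for S'
    using certainty_equivalent_policy[of S'] by blast
  then obtain u where u: "\<And>S'. S' \<subseteq> sensors L \<Longrightarrow> admissible L S' (u S') \<and> square_integrable_control L S' (u S')"
    by metis
  have "is_arg_min (\<lambda>S'. sensing_cost L S' (u S')) (\<lambda>S'. S' \<subseteq> sensors L \<and> card S' \<le> k) S"
    using asm u unfolding sensing_optimal_def by blast
  then have S: "S \<subseteq> sensors L" "card S \<le> k"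
    and opt: "\<And>S'. S' \<subseteq> sensors L \<Longrightarrow> card S' \<le> k \<Longrightarrow> sensing_cost L S (u S) \<le> sensing_cost L S' (u S')"
    unfolding is_arg_min_def by (auto simp: not_less)
  have sq: "square_integrable_control L S \<pi>"
    using asm by (intro certainty_equivalent_square_integrable[OF S(1) adm]) auto
  have regret: "control_regret S \<pi> = 0"
    using asm control_regret_eq_0_iff[OF S(1) adm sq] by blast
  have "lqg_cost L S \<pi> \<le> lqg_cost L S' \<rho>"
    if S': "S' \<subseteq> sensors L" "card S' \<le> k" and \<rho>: "admissible L S' \<rho>" for S' \<rho>
  \<comment> \<open>A competitor of finite cost is square integrable, so the decomposition applies
    to it; one of infinite cost is trivially beaten.\<close>
  proof (cases "lqg_cost L S' \<rho> < \<infinity>")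
    case True
    note sq' = finite_cost_square_integrable[OF S'(1) \<rho> True]
    have "sensing_cost L S \<pi> = sensing_cost L S (u S)" "sensing_cost L S' \<rho> = sensing_cost L S' (u S')"
      using u S S' \<rho> adm sq sq' by (auto intro!: sensing_cost_policy_independent)
    then show ?thesis
      using opt[OF S'] control_regret_nonneg[OF S'(1) \<rho> sq']
      unfolding cost_decomposition(1)[OF S(1) adm sq] cost_decomposition(1)[OF S'(1) \<rho> sq'] regret
      by (intro ennreal_leI) simp
  next
    case False
    then show ?thesis by (simp add: not_less top_unique)
  qed
  then show ?sol
    unfolding lqg_solution_def is_arg_min_def using S adm by (auto simp: not_less)
qed

end

theorem theorem1:
  fixes L :: "('w, 'i::linorder) lqg" and k :: nat and S :: "'i set" and \<pi> :: policy
  assumes "lqg_system L" and "riccati_invertible L"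
  shows "lqg_solution L k S \<pi> \<longleftrightarrow>
    sensing_optimal L k S \<and> admissible L S \<pi> \<and>
    (\<forall>t\<in>{1..horizon L}. AE \<omega> in prob_measure L.
       control L S \<pi> t \<omega> = riccati_K L t *\<^sub>v estimate L S \<pi> t \<omega>)"
proof -
  interpret lqg_problem L by (rule lqg_problem.intro[OF assms])
  show ?thesis by (rule separation)
qed

end
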